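(* Let $S_0\in\mathcal{M}_d(\mathbb{C})^+$ with $\lambda=\lambda(S_0)$, let $m<d$ be an integer, and let $t\ge \operatorname{tr} S_0$. Put $r'=\max\{r_{\lambda,m}(t),\,m\}$ and $c=c_{\lambda,m}(t)$. Then there exists $\nu\in\Lambda(U_t(S_0,m))$ such that: \begin{enumerate} \item $\nu$ is $\prec_w$-minimal in $\Lambda(U_t(S_0,m))$, i.e. $\nu\prec_w\mu$ for every $\mu\in\Lambda(U_t(S_0,m))$. \item For every matrix $S\in U_t(S_0,m)$ the following conditions are equivalent: (a) $\lambda(S)=\nu$ (i.e. $S$ is $\prec_w$-minimal in $U_t(S_0,m)$); (b) there exists an orthonormal basis $\{v_i\}_{i=1}^d$ of eigenvectors for $S_0,\lambda$ such that $$B:=S-S_0=\sum_{i=1}^{d-r'}(c-\lambda_{r'+i})\,v_{r'+i}\otimes v_{r'+i}.$$ \item Assume further that one of the following conditions holds: $m\le 0$; or $m\ge 1$ and $\lambda_m>\lambda_{m+1}$; or $m\ge1$, $\lambda_m=\lambda_{m+1}$ and $t\le s^*(\lambda,m)$. Then the matrices $S\in U_t(S_0,m)$ with $\lambda(S)=\nu$ and $B=S-S_0$ are unique. Moreover, in these cases the formula for $B$ in (b) holds for any orthonormal basis of eigenvectors for $S_0,\lambda$. \end{enumerate}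
   Context: $\mathcal{M}_d(\mathbb{C})^+$ is the set of positive semidefinite complex $d\times d$ matrices. For $S\in\mathcal{M}_d(\mathbb{C})^+$, $\lambda(S)=(\lambda_1(S),\dots,\lambda_d(S))$ is the vector of eigenvalues counted with multiplicity in decreasing order. For $x\in\mathbb{R}^d$, $x^\downarrow$ is its decreasing rearrangement; $x\prec_w y$ means $\sum_{i=1}^k x_i^\downarrow\le\sum_{i=1}^k y_i^\downarrow$ for $k=1,\dots,d$. For Hermitian matrices, $S_1\prec_w S_2$ means $\lambda(S_1)\prec_w\lambda(S_2)$. For vectors, $(x\otimes y)z=\langle z,y\rangle x$. An "orthonormal basis of eigenvectors for $S_0,\lambda$" (where $\lambda=\lambda(S_0)$) is an orthonormal basis $\{v_i\}_{i=1}^d$ of $\mathbb{C}^d$ with $S_0v_i=\lambda_iv_i$ for all $i$. For an integer $m<d$ and $t\ge\operatorname{tr}S_0$, $$U_t(S_0,m)=\{S_0+B:\ B\in\mathcal{M}_d(\mathbb{C})^+,\ \operatorname{rk}B\le d-m,\ \operatorname{tr}(S_0+B)\ge t\},$$ $$\Lambda(U_t(S_0,m))=\{\lambda(S):S\in U_t(S_0,m)\}.$$ Let $\lambda\in\mathbb{R}^d$ have nonnegative decreasing entries, $t_0=\operatorname{tr}\lambda=\sum_i\lambda_i$. For $t\ge t_0$ and $r\in\{0,\dots,d-1\}$ let $p_\lambda(r,t)=\frac{t-\sum_{j=1}^r\lambda_j}{d-r}$, and $$r_\lambda(t)=\min\{r\in\{0,\dots,d-1\}:p_\lambda(r,t)\ge\lambda_{r+1}\},\qquad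 c_\lambda(t)=p_\lambda(r_\lambda(t),t).$$ For $1\le m\le d-1$ let $s^*=s^*(\lambda,m)=\sum_{i=1}^m\lambda_i+(d-m)\lambda_m$ (the unique $s\ge t_0$ with $c_\lambda(s)=\lambda_m$), and for $t\ge t_0$ $$c_{\lambda,m}(t)=\begin{cases}c_\lambda(t)& t\le s^*\\ \lambda_m+\frac{t-s^*}{d-m}& t>s^*\end{cases},\qquad r_{\lambda,m}(t)=\min\{r\in\{0,\dots,d-1\}:c_{\lambda,m}(t)\ge\lambda_{r+1}\}.$$ For $m\le0$ set $c_{\lambda,m}=c_\lambda$ and $r_{\lambda,m}=r_\lambda$. *)

theory Defs
  imports
    "Jordan_Normal_Form.Schur_Decomposition"
    "Jordan_Normal_Form.DL_Rank"
    "HOL-Computational_Algebra.Fundamental_Theorem_Algebra"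
begin

text \<open>
  Vectors of \<open>\<real>\<^sup>d\<close> are real lists of length \<open>d\<close>, matrices and vectors over the complex numbers are
  those of \<open>Jordan_Normal_Form\<close>. All indices start at \<open>0\<close>, so the mathematical entry
  \<open>\<lambda>\<^sub>j\<close> is \<open>lam ! (j - 1)\<close> and \<open>\<lambda>\<^sub>j\<^sub>+\<^sub>1\<close> is \<open>lam ! j\<close>.
\<close>

subsection \<open>Matrices\<close>

definition mat_trace :: "complex mat \<Rightarrow> complex" where
  "mat_trace A = (\<Sum>i<dim_row A. A $$ (i, i))"

definition psd_mats :: "nat \<Rightarrow> complex mat set" where
  "psd_mats d = {A \<in> carrier_mat d d. mat_adjoint A = A \<and>
     (\<forall>v \<in> carrier_vec d. 0 \<le> Re ((A *\<^sub>v v) \<bullet>c v))}"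

text \<open>
  The roots of the characteristic polynomial are counted with algebraic multiplicity. The
  definition is meant for Hermitian matrices, whose eigenvalues are real, so that taking
  real parts only changes the type.
\<close>

definition eigvals_desc :: "complex mat \<Rightarrow> real list" where
  "eigvals_desc A = rev (sorted_list_of_multiset (image_mset Re (proots (char_poly A))))"

lemma length_eigvals_desc:
  assumes "A \<in> carrier_mat d d"
  shows "length (eigvals_desc A) = d"
proof -
  have "length (eigvals_desc A) = size (image_mset Re (proots (char_poly A)))"
    unfolding eigvals_desc_def by (metis length_rev mset_sorted_list_of_multiset size_mset)
  also have "\<dots> = degree (char_poly A)"
    by (simp add: size_proots_complex)
  finally show ?thesis
    using degree_monic_char_poly[OF assms] by simp
qed

definition rank_one :: "complex vec \<Rightarrow> complex vec \<Rightarrow> complex mat" where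
  "rank_one x y = mat (dim_vec x) (dim_vec y) (\<lambda>(i, j). x $ i * conjugate (y $ j))"

lemma rank_one_mult_vec:
  assumes "x \<in> carrier_vec d" "y \<in> carrier_vec d" "z \<in> carrier_vec d"
  shows "rank_one x y *\<^sub>v z = (z \<bullet>c y) \<cdot>\<^sub>v x"
  using assms
  by (intro eq_vecI)
     (auto simp: rank_one_def scalar_prod_def sum_distrib_left sum_distrib_right mult_ac intro!: sum.cong)

definition orthonormal_basis :: "nat \<Rightarrow> (nat \<Rightarrow> complex vec) \<Rightarrow> bool" where
  "orthonormal_basis d v \<longleftrightarrow>
     vectorspace.basis class_ring (module_vec TYPE(complex) d) (v ` {..<d}) \<and>
     (\<forall>i<d. \<forall>j<d. v i \<bullet>c v j = (if i = j then 1 else 0))"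

definition orthonormal_eigenbasis ::
    "nat \<Rightarrow> complex mat \<Rightarrow> real list \<Rightarrow> (nat \<Rightarrow> complex vec) \<Rightarrow> bool" where
  "orthonormal_eigenbasis d S lam v \<longleftrightarrow>
     orthonormal_basis d v \<and>
     (\<forall>i<d. S *\<^sub>v v i = complex_of_real (lam ! i) \<cdot>\<^sub>v v i)"

subsection \<open>Weak majorization\<close>

definition decreasing_rearr :: "real list \<Rightarrow> real list" where
  "decreasing_rearr x = rev (sort x)"

definition weakly_majorized :: "real list \<Rightarrow> real list \<Rightarrow> bool" (infix "\<prec>\<^sub>w" 50) where
  "x \<prec>\<^sub>w y \<longleftrightarrow> length x = length y \<and>
     (\<forall>k\<in>{1..length x}. (\<Sum>i<k. decreasing_rearr x ! i) \<le> (\<Sum>i<k. decreasing_rearr y ! i))"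

subsection \<open>The sets \<open>U\<^sub>t(S\<^sub>0, m)\<close> and \<open>\<Lambda>(U\<^sub>t(S\<^sub>0, m))\<close>\<close>

text \<open>The integer \<open>m\<close> may be negative. The trace below is real because the matrix is Hermitian.\<close>

definition U_set :: "nat \<Rightarrow> real \<Rightarrow> complex mat \<Rightarrow> int \<Rightarrow> complex mat set" where
  "U_set d t S0 m = {S0 + B | B. B \<in> psd_mats d \<and> int (vec_space.rank d B) \<le> int d - m \<and>
     t \<le> Re (mat_trace (S0 + B))}"

definition Lambda_U :: "nat \<Rightarrow> real \<Rightarrow> complex mat \<Rightarrow> int \<Rightarrow> real list set" where
  "Lambda_U d t S0 m = eigvals_desc ` U_set d t S0 m"

subsection \<open>The parameters \<open>r\<close> and \<open>c\<close>\<close>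

text \<open>
  Here \<open>d\<close> is \<open>length lam\<close>. The list is nonempty, decreasing and nonnegative and \<open>t\<close> is at least
  its sum; then both minima range over nonempty sets, since \<open>r = d - 1\<close> is admissible.
\<close>

definition p_val :: "real list \<Rightarrow> nat \<Rightarrow> real \<Rightarrow> real" where
  "p_val lam r t = (t - (\<Sum>j<r. lam ! j)) / (real (length lam) - real r)"

definition r_val :: "real list \<Rightarrow> real \<Rightarrow> nat" where
  "r_val lam t = Min {r \<in> {0..<length lam}. p_val lam r t \<ge> lam ! r}"

definition c_val :: "real list \<Rightarrow> real \<Rightarrow> real" where
  "c_val lam t = p_val lam (r_val lam t) t"

definition s_star :: "real list \<Rightarrow> nat \<Rightarrow> real" where
  "s_star lam m = (\<Sum>i<m. lam ! i) + (real (length lam) - real m) * lam ! (m - 1)"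

definition c_val_m :: "real list \<Rightarrow> int \<Rightarrow> real \<Rightarrow> real" where
  "c_val_m lam m t =
     (if m \<le> 0 \<or> t \<le> s_star lam (nat m) then c_val lam t
      else lam ! (nat m - 1) + (t - s_star lam (nat m)) / (real (length lam) - real (nat m)))"

definition r_val_m :: "real list \<Rightarrow> int \<Rightarrow> real \<Rightarrow> nat" where
  "r_val_m lam m t =
     (if m \<le> 0 then r_val lam t
      else Min {r \<in> {0..<length lam}. c_val_m lam m t \<ge> lam ! r})"

end

theory Submission
  imports Defs "HOL-Combinatorics.List_Permutation"
begin

text \<open>
  Ky Fan's inequality, applied to bases adapted to \<open>S\<^sub>0\<close> and to the kernel of \<open>B\<close>, bounds the
  partial sums of the eigenvalues of \<open>S\<^sub>0 + B\<close> from below outside of the range of indices where the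
  minimal vector is constant; in that range concavity of partial sums suffices. If \<open>S\<^sub>0 + B\<close> attains
  the minimum, equality in these estimates forces \<open>B\<close> to vanish on an \<open>r'\<close>-dimensional subspace
  invariant under \<open>S\<^sub>0\<close> and \<open>S\<^sub>0 + B\<close> to act as \<open>c\<close> on its orthogonal complement. Diagonalizing
  \<open>S\<^sub>0\<close> on both subspaces and comparing multisets of eigenvalues gives the required eigenbasis.
  In the uniqueness cases the eigenvalues of \<open>B\<close> are a function of those of \<open>S\<^sub>0\<close>, so that \<open>B\<close>
  does not depend on the eigenbasis.
\<close>

section \<open>Orthonormal families\<close>

text \<open>The obstacle is the rank bound: for \<open>m \<ge> 1\<close> it forces \<open>B\<close>
  to vanish on a subspace of dimension at least \<open>m\<close>, but nothing makes that subspace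
  invariant under \<open>S0\<close>. Only part of the kernel is ever used: as long as
  \<open>rank B + k < d\<close>, there is a unit kernel vector of \<open>B\<close> orthogonal to any
  \<open>k\<close> given orthonormal vectors, so leading eigenvectors of \<open>S0\<close> can be
  continued by kernel vectors. Write \<open>j\<close> for \<open>r_val_m lam m t\<close>. Either
  \<open>j = r'\<close>, and no kernel vectors are called for, or \<open>r' = m\<close>, and the
  rank bound supplies enough of them. The level \<open>c\<close> is dictated by the trace: raising
  the last \<open>d - r'\<close> eigenvalues of \<open>S0\<close> to \<open>c\<close> gives trace
  \<open>t\<close>. If \<open>j < r'\<close>, the entries \<open>j, ..., r' - 1\<close> are at most
  \<open>c\<close> and sink behind the plateau of value \<open>c\<close>, which therefore starts at
  \<open>j\<close> and not at \<open>r'\<close>. Commutation of \<open>S0\<close> and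
  \<open>B\<close> is never assumed; it comes out of the discussion of equality.\<close>

lemma index_mat_adjoint:
  fixes A :: "complex mat"
  assumes "i < dim_col A" "j < dim_row A"
  shows "mat_adjoint A $$ (i, j) = cnj (A $$ (j, i))"
  using assms by (simp add: mat_adjoint_def mat_of_rows_index)

lemma dim_mat_adjoint [simp]:
  "dim_row (mat_adjoint A) = dim_col A" "dim_col (mat_adjoint A) = dim_row A"
  by (simp_all add: mat_adjoint_def)

lemma mat_adjoint_carrier:
  "A \<in> carrier_mat n m \<Longrightarrow> mat_adjoint A \<in> carrier_mat m n"
  by (auto simp: mat_adjoint_def)

lemma cscalar_sum:
  fixes x :: "complex vec"
  assumes "y \<in> carrier_vec d"
  shows "x \<bullet>c y = (\<Sum>a<d. x $ a * cnj (y $ a))"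
  using assms by (auto simp: scalar_prod_def atLeast0LessThan intro!: sum.cong)

lemma mult_mat_vec_sum:
  assumes "A \<in> carrier_mat n m" "x \<in> carrier_vec m" "i < n"
  shows "(A *\<^sub>v x) $ i = (\<Sum>k<m. A $$ (i, k) * x $ k)"
  using assms by (auto simp: scalar_prod_def atLeast0LessThan intro!: sum.cong)

lemma cscalar_adjoint:
  fixes A :: "complex mat"
  assumes A: "A \<in> carrier_mat n m" and x: "x \<in> carrier_vec m" and y: "y \<in> carrier_vec n"
  shows "(A *\<^sub>v x) \<bullet>c y = x \<bullet>c (mat_adjoint A *\<^sub>v y)"
proof -
  note A' = mat_adjoint_carrier[OF A]
  have "(A *\<^sub>v x) \<bullet>c y = (\<Sum>a<n. \<Sum>k<m. A $$ (a, k) * x $ k * cnj (y $ a))"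
    using A x y by (simp add: cscalar_sum[OF y] mult_mat_vec_sum[OF A x] sum_distrib_right
        del: index_mult_mat_vec)
  also have "\<dots> = (\<Sum>k<m. \<Sum>a<n. A $$ (a, k) * x $ k * cnj (y $ a))"
    by (rule sum.swap)
  also have "\<dots> = (\<Sum>k<m. x $ k * cnj ((mat_adjoint A *\<^sub>v y) $ k))"
    using A by (intro sum.cong refl)
      (simp add: mult_mat_vec_sum[OF A' y] index_mat_adjoint sum_distrib_left mult_ac
        del: index_mult_mat_vec)
  also have "\<dots> = x \<bullet>c (mat_adjoint A *\<^sub>v y)"
    using A' y by (intro cscalar_sum[symmetric]) auto
  finally show ?thesis .
qed

lemma cscalar_commute:
  fixes x :: "complex vec"
  assumes "x \<in> carrier_vec d" "y \<in> carrier_vec d"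
  shows "y \<bullet>c x = cnj (x \<bullet>c y)"
  using assms by (simp add: cscalar_sum mult_ac)

lemma cscalar_self:
  fixes x :: "complex vec"
  assumes "x \<in> carrier_vec d"
  shows "x \<bullet>c x = of_real (\<Sum>a<d. (cmod (x $ a))\<^sup>2)"
  using assms by (simp add: cscalar_sum complex_norm_square del: of_real_power)

text \<open>Indices from \<open>n\<close> on are unconstrained, so a family is extended by a
  function update and reordered by composition with a permutation.\<close>

definition orthonormal_family :: "nat \<Rightarrow> nat \<Rightarrow> (nat \<Rightarrow> complex vec) \<Rightarrow> bool" where
  "orthonormal_family d n v \<longleftrightarrow> (\<forall>i<n. v i \<in> carrier_vec d) \<and>
     (\<forall>i<n. \<forall>j<n. v i \<bullet>c v j = (if i = j then 1 else 0))"

lemma orthonormal_familyD: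
  assumes "orthonormal_family d n v"
  shows "i < n \<Longrightarrow> v i \<in> carrier_vec d"
    and "i < n \<Longrightarrow> j < n \<Longrightarrow> v i \<bullet>c v j = (if i = j then 1 else 0)"
  using assms by (auto simp: orthonormal_family_def)

definition cols_of :: "nat \<Rightarrow> nat \<Rightarrow> (nat \<Rightarrow> complex vec) \<Rightarrow> complex mat" where
  "cols_of d n v = mat d n (\<lambda>(a, k). v k $ a)"

lemma cols_of_carrier [simp]: "cols_of d n v \<in> carrier_mat d n"
  by (simp add: cols_of_def)

lemma dim_cols_of [simp]: "dim_row (cols_of d n v) = d" "dim_col (cols_of d n v) = n"
  by (simp_all add: cols_of_def)

lemma col_cols_of: "k < n \<Longrightarrow> v k \<in> carrier_vec d \<Longrightarrow> col (cols_of d n v) k = v k"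
  by (intro eq_vecI) (auto simp: cols_of_def)

lemma adjoint_cols_of_mult_vec:
  assumes "\<And>k. k < n \<Longrightarrow> v k \<in> carrier_vec d" "x \<in> carrier_vec d" "k < n"
  shows "(mat_adjoint (cols_of d n v) *\<^sub>v x) $ k = x \<bullet>c v k"
proof -
  have "(mat_adjoint (cols_of d n v) *\<^sub>v x) $ k
      = (\<Sum>a<d. mat_adjoint (cols_of d n v) $$ (k, a) * x $ a)"
    using assms by (intro mult_mat_vec_sum[of _ n]) (auto intro: mat_adjoint_carrier)
  also have "\<dots> = (\<Sum>a<d. x $ a * cnj (v k $ a))"
    using assms by (intro sum.cong) (simp_all add: index_mat_adjoint, simp_all add: cols_of_def)
  also have "\<dots> = x \<bullet>c v k"
    using assms by (intro cscalar_sum[symmetric]) auto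
  finally show ?thesis .
qed

lemma cols_of_mult_vec_cscalar:
  assumes v: "\<And>k. k < n \<Longrightarrow> v k \<in> carrier_vec d" and x: "x \<in> carrier_vec n"
    and y: "y \<in> carrier_vec d"
  shows "(cols_of d n v *\<^sub>v x) \<bullet>c y = (\<Sum>k<n. x $ k * (v k \<bullet>c y))"
proof -
  have "(cols_of d n v *\<^sub>v x) \<bullet>c y = x \<bullet>c (mat_adjoint (cols_of d n v) *\<^sub>v y)"
    using x y by (intro cscalar_adjoint[of _ d n]) auto
  also have "\<dots> = (\<Sum>k<n. x $ k * cnj ((mat_adjoint (cols_of d n v) *\<^sub>v y) $ k))"
    using y by (intro cscalar_sum) (auto intro!: mult_mat_vec_carrier mat_adjoint_carrier)
  also have "\<dots> = (\<Sum>k<n. x $ k * (v k \<bullet>c y))"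
    using v y by (intro sum.cong refl)
      (simp add: adjoint_cols_of_mult_vec[OF v y] cscalar_commute[of y d]
        del: index_mult_mat_vec)
  finally show ?thesis .
qed

lemma adjoint_cols_of_mult:
  assumes v: "orthonormal_family d n v"
  shows "mat_adjoint (cols_of d n v) * cols_of d n v = 1\<^sub>m n"
proof (rule eq_matI)
  fix i k assume "i < dim_row (1\<^sub>m n :: complex mat)" "k < dim_col (1\<^sub>m n :: complex mat)"
  then have ik: "i < n" "k < n" by auto
  note vD = orthonormal_familyD[OF v]
  have "(mat_adjoint (cols_of d n v) * cols_of d n v) $$ (i, k)
      = (mat_adjoint (cols_of d n v) *\<^sub>v col (cols_of d n v) k) $ i"
    using ik by simp
  also have "\<dots> = v k \<bullet>c v i"
    using ik vD by (simp add: col_cols_of adjoint_cols_of_mult_vec del: index_mult_mat_vec)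
  finally show "(mat_adjoint (cols_of d n v) * cols_of d n v) $$ (i, k) = 1\<^sub>m n $$ (i, k)"
    using ik vD(2)[of k i] by simp
qed auto

text \<open>Orthonormality gives a left inverse; for a square matrix it is also a right inverse.
  Completeness of the family, and hence \<open>parseval\<close>, comes from this step.\<close>

lemma cols_of_mult_adjoint:
  assumes v: "orthonormal_family d d v"
  shows "cols_of d d v * mat_adjoint (cols_of d d v) = 1\<^sub>m d"
  by (rule mat_mult_left_right_inverse[OF _ _ adjoint_cols_of_mult[OF v]])
    (auto intro: mat_adjoint_carrier)

lemma parseval:
  assumes v: "orthonormal_family d d v" and x: "x \<in> carrier_vec d" and y: "y \<in> carrier_vec d"
  shows "x \<bullet>c y = (\<Sum>i<d. (x \<bullet>c v i) * cnj (y \<bullet>c v i))"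
proof -
  let ?U = "cols_of d d v"
  have U': "mat_adjoint ?U \<in> carrier_mat d d"
    by (intro mat_adjoint_carrier) simp
  have "x \<bullet>c y = (?U *\<^sub>v (mat_adjoint ?U *\<^sub>v x)) \<bullet>c y"
    using assoc_mult_mat_vec[of ?U d d "mat_adjoint ?U" d x] x U'
    by (simp add: cols_of_mult_adjoint[OF v])
  also have "\<dots> = (mat_adjoint ?U *\<^sub>v x) \<bullet>c (mat_adjoint ?U *\<^sub>v y)"
    using x y U' by (intro cscalar_adjoint[of _ d d]) auto
  also have "\<dots> = (\<Sum>i<d. (mat_adjoint ?U *\<^sub>v x) $ i * cnj ((mat_adjoint ?U *\<^sub>v y) $ i))"
    using U' y by (intro cscalar_sum) auto
  also have "\<dots> = (\<Sum>i<d. (x \<bullet>c v i) * cnj (y \<bullet>c v i))"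
    using x y orthonormal_familyD(1)[OF v]
    by (intro sum.cong refl) (simp add: adjoint_cols_of_mult_vec del: index_mult_mat_vec)
  finally show ?thesis .
qed

lemma parseval_norm:
  assumes v: "orthonormal_family d d v" and x: "x \<in> carrier_vec d"
  shows "x \<bullet>c x = of_real (\<Sum>i<d. (cmod (x \<bullet>c v i))\<^sup>2)"
  by (simp add: parseval[OF v x x] complex_norm_square del: of_real_power)

lemma vec_eq_basisI:
  assumes v: "orthonormal_family d d v" and x: "x \<in> carrier_vec d" and y: "y \<in> carrier_vec d"
    and eq: "\<And>i. i < d \<Longrightarrow> x \<bullet>c v i = y \<bullet>c v i"
  shows "x = y"
proof -
  have "(x - y) \<bullet>c v i = 0" if "i < d" for i
    using that eq x y orthonormal_familyD(1)[OF v that]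
    by (simp add: minus_scalar_prod_distrib[of _ d])
  then have "(x - y) \<bullet>c (x - y) = 0"
    using parseval_norm[OF v, of "x - y"] x y by simp
  then have "x - y = 0\<^sub>v d"
    using x y conjugate_square_eq_0_vec[of "x - y" d] by simp
  then have "(x - y) $ a = 0" if "a < d" for a
    using that by simp
  then show ?thesis
    using x y by (intro eq_vecI) auto
qed

lemma mat_eq_basisI:
  assumes v: "orthonormal_family d d v"
    and M: "M \<in> carrier_mat d d" and N: "N \<in> carrier_mat d d"
    and eq: "\<And>i. i < d \<Longrightarrow> M *\<^sub>v v i = N *\<^sub>v v i"
  shows "M = N"
proof -
  let ?U = "cols_of d d v"
  have U': "mat_adjoint ?U \<in> carrier_mat d d"
    by (intro mat_adjoint_carrier) simp
  have "M * ?U = N * ?U"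
  proof (rule mat_col_eqI)
    fix i assume "i < dim_col (N * ?U)"
    then have i: "i < d" by (simp add: cols_of_def)
    show "col (M * ?U) i = col (N * ?U) i"
      using i M N eq[OF i] orthonormal_familyD(1)[OF v i]
      by (simp add: col_mult2[of _ d d _ d] col_cols_of)
  qed (use M N in auto)
  then have "M * (?U * mat_adjoint ?U) = N * (?U * mat_adjoint ?U)"
    using assoc_mult_mat[OF M _ U', of ?U] assoc_mult_mat[OF N _ U', of ?U] by simp
  then show ?thesis
    using M N by (simp add: cols_of_mult_adjoint[OF v])
qed

text \<open>Written entrywise, so that ordinary sums apply and no carrier conditions on the vectors
  intrude.\<close>

definition spectral_sum ::
    "nat \<Rightarrow> nat set \<Rightarrow> (nat \<Rightarrow> real) \<Rightarrow> (nat \<Rightarrow> complex vec) \<Rightarrow> complex mat" where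
  "spectral_sum d I g v = mat d d (\<lambda>(a, b). \<Sum>i\<in>I. of_real (g i) * (v i $ a * cnj (v i $ b)))"

lemma spectral_sum_carrier [simp]: "spectral_sum d I g v \<in> carrier_mat d d"
  by (simp add: spectral_sum_def)

lemma dim_spectral_sum [simp]:
  "dim_row (spectral_sum d I g v) = d" "dim_col (spectral_sum d I g v) = d"
  by (simp_all add: spectral_sum_def)

lemma spectral_sum_cscalar:
  assumes "\<And>i. i \<in> I \<Longrightarrow> v i \<in> carrier_vec d" "x \<in> carrier_vec d" "y \<in> carrier_vec d"
  shows "(spectral_sum d I g v *\<^sub>v x) \<bullet>c y = (\<Sum>i\<in>I. of_real (g i) * (x \<bullet>c v i) * cnj (y \<bullet>c v i))"
proof -
  have "(spectral_sum d I g v *\<^sub>v x) \<bullet>c y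
     = (\<Sum>a<d. (\<Sum>b<d. spectral_sum d I g v $$ (a, b) * x $ b) * cnj (y $ a))"
    using assms by (simp add: cscalar_sum mult_mat_vec_sum[of _ d d] del: index_mult_mat_vec)
  also have "\<dots> = (\<Sum>a<d. \<Sum>b<d. \<Sum>i\<in>I. of_real (g i) * (v i $ a * cnj (v i $ b)) * x $ b * cnj (y $ a))"
    by (simp add: spectral_sum_def sum_distrib_right)
  also have "\<dots> = (\<Sum>i\<in>I. \<Sum>a<d. \<Sum>b<d. of_real (g i) * (v i $ a * cnj (v i $ b)) * x $ b * cnj (y $ a))"
    by (subst sum.swap[of _ I], subst sum.swap[of _ I]) simp
  also have "\<dots> = (\<Sum>i\<in>I. of_real (g i) * (x \<bullet>c v i) * cnj (y \<bullet>c v i))"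
  proof (intro sum.cong refl)
    fix i assume "i \<in> I"
    then have v: "v i \<in> carrier_vec d" using assms by auto
    show "(\<Sum>a<d. \<Sum>b<d. of_real (g i) * (v i $ a * cnj (v i $ b)) * x $ b * cnj (y $ a))
        = of_real (g i) * (x \<bullet>c v i) * cnj (y \<bullet>c v i)"
      unfolding cscalar_sum[OF v]
      by (subst sum.swap) (simp add: sum_distrib_left sum_distrib_right mult_ac)
  qed
  finally show ?thesis .
qed

lemma rank_spectral_sum_le:
  assumes "finite I"
  shows "vec_space.rank d (spectral_sum d I g v) \<le> card I"
  using assms
proof (induction I)
  case empty
  have "spectral_sum d {} g v = 0\<^sub>m d d"
    by (intro eq_matI) (auto simp: spectral_sum_def)
  then show ?case
    using vec_space.rank_0I[of d d] by simp
next
  case (insert j I)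
  have "spectral_sum d (insert j I) g v = spectral_sum d {j} g v + spectral_sum d I g v"
    using insert by (intro eq_matI) (auto simp: spectral_sum_def)
  moreover have "vec_space.rank d (spectral_sum d {j} g v) \<le> 1"
    by (rule vec_space.rank_le_1_product_entries[where nc = d
          and f = "\<lambda>a. of_real (g j) * v j $ a" and g = "\<lambda>b. cnj (v j $ b)"])
      (auto simp: spectral_sum_def)
  ultimately show ?case
    using insert vec_space.rank_subadditive[of "spectral_sum d {j} g v" d d "spectral_sum d I g v"]
    by simp
qed

lemma adjoint_spectral_sum: "mat_adjoint (spectral_sum d I g v) = spectral_sum d I g v"
proof (rule eq_matI)
  fix i j assume "i < dim_row (spectral_sum d I g v)" "j < dim_col (spectral_sum d I g v)"
  then show "mat_adjoint (spectral_sum d I g v) $$ (i, j) = spectral_sum d I g v $$ (i, j)"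
    by (simp add: index_mat_adjoint) (simp add: spectral_sum_def mult_ac)
qed auto

section \<open>Extending orthonormal families\<close>

text \<open>A vector in the kernel of the nonnegative form of \<open>B + \<Sum> u\<^sub>i u\<^sub>i\<^sup>*\<close> is
  in the kernel of every summand, and the rank of this matrix is less than \<open>d\<close>.\<close>

lemma extend_orthonormal_step:
  assumes u: "orthonormal_family d k u" and B: "B \<in> carrier_mat d d"
    and nonneg: "\<And>x. x \<in> carrier_vec d \<Longrightarrow> 0 \<le> Re ((B *\<^sub>v x) \<bullet>c x)"
    and rank: "vec_space.rank d B + k < d"
  obtains x where "x \<in> carrier_vec d" "x \<bullet>c x = 1" "Re ((B *\<^sub>v x) \<bullet>c x) = 0"
    "\<And>i. i < k \<Longrightarrow> x \<bullet>c u i = 0"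
proof -
  let ?P = "spectral_sum d {..<k} (\<lambda>_. 1) u"
  note uD = orthonormal_familyD[OF u]
  have "vec_space.rank d (B + ?P) \<le> vec_space.rank d B + vec_space.rank d ?P"
    using B by (intro vec_space.rank_subadditive[of _ d d]) auto
  also have "\<dots> < d"
    using rank rank_spectral_sum_le[of "{..<k}" d "\<lambda>_. 1" u] by simp
  finally have "det (B + ?P) = 0"
    using vec_space.det_rank_iff[of "B + ?P" d] B by fastforce
  then obtain x where x: "x \<in> carrier_vec d" "x \<noteq> 0\<^sub>v d" "(B + ?P) *\<^sub>v x = 0\<^sub>v d"
    using det_0_iff_vec_prod_zero[of "B + ?P" d] B by auto
  have "0 = ((B + ?P) *\<^sub>v x) \<bullet>c x"
    using x by simp
  also have "\<dots> = (B *\<^sub>v x) \<bullet>c x + (?P *\<^sub>v x) \<bullet>c x"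
    using x(1) B mult_mat_vec_carrier[of B d d x] mult_mat_vec_carrier[of ?P d d x]
    by (simp add: add_mult_distrib_mat_vec[of _ d d] add_scalar_prod_distrib[of _ d])
  also have "(?P *\<^sub>v x) \<bullet>c x = of_real (\<Sum>i<k. (cmod (x \<bullet>c u i))\<^sup>2)"
    using x(1) uD
    by (subst spectral_sum_cscalar) (simp_all add: complex_norm_square del: of_real_power)
  finally have "Re ((B *\<^sub>v x) \<bullet>c x) + (\<Sum>i<k. (cmod (x \<bullet>c u i))\<^sup>2) = 0"
    by (metis Re_complex_of_real plus_complex.simps(1) zero_complex.simps(1))
  moreover have "0 \<le> (\<Sum>i<k. (cmod (x \<bullet>c u i))\<^sup>2)"
    by (intro sum_nonneg) auto
  ultimately have B0: "Re ((B *\<^sub>v x) \<bullet>c x) = 0" and "(\<Sum>i<k. (cmod (x \<bullet>c u i))\<^sup>2) = 0"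
    using nonneg[OF x(1)] by linarith+
  then have u0: "x \<bullet>c u i = 0" if "i < k" for i
    using that by (simp add: sum_nonneg_eq_0_iff)
  define n2 where "n2 = (\<Sum>a<d. (cmod (x $ a))\<^sup>2)"
  have xx: "x \<bullet>c x = of_real n2"
    using cscalar_self[OF x(1)] by (simp add: n2_def)
  have "n2 \<noteq> 0"
    using xx x conjugate_square_eq_0_vec[OF x(1)] by auto
  moreover have "n2 \<ge> 0"
    unfolding n2_def by (intro sum_nonneg) auto
  ultimately have pos: "n2 > 0" by simp
  define s where "s = complex_of_real (1 / sqrt n2)"
  have cs: "conjugate s = s" "s * (s * of_real n2) = 1"
    using pos by (simp_all add: s_def field_simps flip: of_real_mult)
  have c: "s \<cdot>\<^sub>v x \<in> carrier_vec d" using x by simp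
  show ?thesis
  proof
    show "s \<cdot>\<^sub>v x \<in> carrier_vec d" by fact
    show "(s \<cdot>\<^sub>v x) \<bullet>c (s \<cdot>\<^sub>v x) = 1"
      using x(1) xx cs by (simp add: conjugate_smult_vec)
    show "(s \<cdot>\<^sub>v x) \<bullet>c u i = 0" if "i < k" for i
      using u0[OF that] x(1) uD(1)[OF that] by simp
    have "(B *\<^sub>v (s \<cdot>\<^sub>v x)) \<bullet>c (s \<cdot>\<^sub>v x) = s * (s * ((B *\<^sub>v x) \<bullet>c x))"
      using x(1) B cs(1) by (simp add: conjugate_smult_vec mult_mat_vec[of _ d d])
    then show "Re ((B *\<^sub>v (s \<cdot>\<^sub>v x)) \<bullet>c (s \<cdot>\<^sub>v x)) = 0"
      using B0 by (simp add: s_def)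
  qed
qed

text \<open>For the new vectors only the form of \<open>B\<close> is shown to vanish. That
  \<open>B\<close> itself annihilates them is obtained later in \<open>psd_form_eq_0\<close> from
  the spectral theorem, whose proof relies on this lemma with \<open>B = 0\<close>.\<close>

lemma extend_orthonormal:
  assumes v: "orthonormal_family d l v" and B: "B \<in> carrier_mat d d"
    and nonneg: "\<And>x. x \<in> carrier_vec d \<Longrightarrow> 0 \<le> Re ((B *\<^sub>v x) \<bullet>c x)"
    and "l \<le> n" "vec_space.rank d B + n \<le> d"
  shows "\<exists>u. orthonormal_family d n u \<and> (\<forall>i<l. u i = v i) \<and>
    (\<forall>i. l \<le> i \<longrightarrow> i < n \<longrightarrow> Re ((B *\<^sub>v u i) \<bullet>c u i) = 0)"
  using assms(4,5)
proof (induction n rule: dec_induct)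
  case base
  then show ?case using v by auto
next
  case (step k)
  then obtain u where u: "orthonormal_family d k u" "\<forall>i<l. u i = v i"
      "\<forall>i. l \<le> i \<longrightarrow> i < k \<longrightarrow> Re ((B *\<^sub>v u i) \<bullet>c u i) = 0"
    by auto
  obtain x where x: "x \<in> carrier_vec d" "x \<bullet>c x = 1" "Re ((B *\<^sub>v x) \<bullet>c x) = 0"
      "\<And>i. i < k \<Longrightarrow> x \<bullet>c u i = 0"
    using extend_orthonormal_step[OF u(1) B nonneg] step.prems by auto
  note uD = orthonormal_familyD[OF u(1)]
  have "u i \<bullet>c x = 0" if "i < k" for i
    using cscalar_commute[OF x(1) uD(1)[OF that]] x(4)[OF that] by simp
  then have *: "orthonormal_family d (Suc k) (u(k := x))"
    using uD x by (auto simp: orthonormal_family_def less_Suc_eq)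
  show ?case
    by (rule exI[of _ "u(k := x)"], rule conjI[OF *])
      (use u(2,3) x(3) step.hyps in \<open>auto simp: less_Suc_eq\<close>)
qed

lemma extend_orthonormal_basis:
  assumes v: "orthonormal_family d l v" and "l \<le> d"
  obtains u where "orthonormal_family d d u" "\<And>i. i < l \<Longrightarrow> u i = v i"
proof -
  have "0 \<le> Re ((0\<^sub>m d d *\<^sub>v x) \<bullet>c x)" if "x \<in> carrier_vec d" for x :: "complex vec"
  proof -
    have "0\<^sub>m d d *\<^sub>v x = 0\<^sub>v d"
      using that by (intro eq_vecI) auto
    then show ?thesis using that by simp
  qed
  then show ?thesis
    using extend_orthonormal[OF v, of "0\<^sub>m d d" d] assms vec_space.rank_0I[of d d] that by auto
qed

section \<open>The spectral theorem\<close>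

lemma hermitian_cscalar:
  fixes A :: "complex mat"
  assumes "A \<in> carrier_mat d d" "mat_adjoint A = A" "x \<in> carrier_vec d" "y \<in> carrier_vec d"
  shows "(A *\<^sub>v x) \<bullet>c y = x \<bullet>c (A *\<^sub>v y)"
  using cscalar_adjoint[OF assms(1,3,4)] assms(2) by simp

definition real_eigenvectors ::
    "complex mat \<Rightarrow> nat \<Rightarrow> (nat \<Rightarrow> complex vec) \<Rightarrow> (nat \<Rightarrow> real) \<Rightarrow> bool" where
  "real_eigenvectors A n v a \<longleftrightarrow> (\<forall>i<n. A *\<^sub>v v i = of_real (a i) \<cdot>\<^sub>v v i)"

text \<open>A predicate on the dimension alone, so that \<open>diagonalize_block\<close> can take it
  as a hypothesis: inside the induction it is the induction hypothesis, afterwards a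
  theorem.\<close>

definition hermitian_diagonalizable :: "nat \<Rightarrow> bool" where
  "hermitian_diagonalizable n \<longleftrightarrow> (\<forall>A \<in> carrier_mat n n. mat_adjoint A = A \<longrightarrow>
     (\<exists>v a. orthonormal_family n n v \<and> real_eigenvectors A n v a))"

text \<open>The matrix of \<open>A\<close> on the invariant span of \<open>u p, \<dots>, u (p + n - 1)\<close> is diagonalized in
  coordinates, and the coordinate vectors are mapped back.\<close>

lemma diagonalize_block:
  assumes diag: "hermitian_diagonalizable n"
    and A: "A \<in> carrier_mat d d" "mat_adjoint A = A"
    and u: "orthonormal_family d d u" and pn: "p + n \<le> d"
    and inv: "\<And>k i. k < n \<Longrightarrow> i < d \<Longrightarrow> i \<notin> {p..<p + n} \<Longrightarrow> (A *\<^sub>v u (p + k)) \<bullet>c u i = 0"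
  obtains w a where "orthonormal_family d n w" "real_eigenvectors A n w a"
    "\<And>k i. k < n \<Longrightarrow> i < d \<Longrightarrow> i \<notin> {p..<p + n} \<Longrightarrow> w k \<bullet>c u i = 0"
proof -
  define C where "C = mat n n (\<lambda>(i, k). (A *\<^sub>v u (p + k)) \<bullet>c u (p + i))"
  have C: "C \<in> carrier_mat n n" by (simp add: C_def)
  have uc: "u i \<in> carrier_vec d" if "i < d" for i
    using orthonormal_familyD(1)[OF u that] .
  have upc: "u (p + k) \<in> carrier_vec d" if "k < n" for k
    using uc that pn by simp
  have Au: "A *\<^sub>v u (p + k) \<in> carrier_vec d" if "k < n" for k
    using A(1) upc[OF that] by simp
  have "mat_adjoint C = C"
  proof (rule eq_matI)
    fix i k assume "i < dim_row C" "k < dim_col C"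
    then have ik: "i < n" "k < n" by (auto simp: C_def)
    have "cnj ((A *\<^sub>v u (p + i)) \<bullet>c u (p + k)) = u (p + k) \<bullet>c (A *\<^sub>v u (p + i))"
      using cscalar_commute[OF Au[OF ik(1)] upc[OF ik(2)]] by simp
    also have "\<dots> = (A *\<^sub>v u (p + k)) \<bullet>c u (p + i)"
      using hermitian_cscalar[OF A upc[OF ik(2)] upc[OF ik(1)]] by simp
    finally show "mat_adjoint C $$ (i, k) = C $$ (i, k)"
      using ik C by (simp add: index_mat_adjoint) (simp add: C_def)
  qed (use C in auto)
  with diag C obtain x a where x: "orthonormal_family n n x" "real_eigenvectors C n x a"
    unfolding hermitian_diagonalizable_def by blast
  have xc: "x j \<in> carrier_vec n" if "j < n" for j
    using orthonormal_familyD(1)[OF x(1) that] .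
  define U where "U = cols_of d n (\<lambda>k. u (p + k))"
  have U: "U \<in> carrier_mat d n" by (simp add: U_def)
  have o: "orthonormal_family d n (\<lambda>k. u (p + k))"
    using orthonormal_familyD[OF u] pn by (auto simp: orthonormal_family_def)
  define w where "w j = U *\<^sub>v x j" for j
  have wc: "w j \<in> carrier_vec d" if "j < n" for j
    using U xc[OF that] by (simp add: w_def)
  have w_cs: "w j \<bullet>c y = (\<Sum>k<n. x j $ k * (u (p + k) \<bullet>c y))" if "j < n" "y \<in> carrier_vec d" for j y
    using cols_of_mult_vec_cscalar[of n "\<lambda>k. u (p + k)" d "x j" y] upc xc that
    by (simp add: w_def U_def)
  have w_out: "w k \<bullet>c u i = 0" if "k < n" "i < d" "i \<notin> {p..<p + n}" for k i
    using that pn orthonormal_familyD(2)[OF u]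
    by (subst w_cs) (auto simp: uc intro!: sum.neutral)
  have w_in: "w k \<bullet>c u (p + i) = x k $ i" if "k < n" "i < n" for k i
  proof -
    have "w k \<bullet>c u (p + i) = (\<Sum>l<n. x k $ l * (if l = i then 1 else 0))"
      using that pn orthonormal_familyD(2)[OF u]
      by (subst w_cs) (auto simp: uc intro!: sum.cong)
    also have "\<dots> = x k $ i"
      using that by (simp add: if_distrib cong: if_cong)
    finally show ?thesis .
  qed
  have Aw_cs: "(A *\<^sub>v w j) \<bullet>c y = (\<Sum>k<n. x j $ k * ((A *\<^sub>v u (p + k)) \<bullet>c y))"
    if "j < n" "y \<in> carrier_vec d" for j y
  proof -
    have "(A *\<^sub>v w j) \<bullet>c y = w j \<bullet>c (A *\<^sub>v y)"
      using hermitian_cscalar[OF A wc[OF that(1)] that(2)] .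
    also have "\<dots> = (\<Sum>k<n. x j $ k * (u (p + k) \<bullet>c (A *\<^sub>v y)))"
      using w_cs[of j "A *\<^sub>v y"] A(1) that by simp
    also have "\<dots> = (\<Sum>k<n. x j $ k * ((A *\<^sub>v u (p + k)) \<bullet>c y))"
      using hermitian_cscalar[OF A] upc that(2) by (intro sum.cong refl) simp
    finally show ?thesis .
  qed
  have "orthonormal_family d n w"
    unfolding orthonormal_family_def
  proof (intro conjI allI impI)
    fix i j assume ij: "i < n" "j < n"
    have "w i \<bullet>c w j = x i \<bullet>c (mat_adjoint U *\<^sub>v w j)"
      using cscalar_adjoint[OF U xc[OF ij(1)] wc[OF ij(2)]] by (simp add: w_def)
    also have "mat_adjoint U *\<^sub>v w j = x j"
      using assoc_mult_mat_vec[OF mat_adjoint_carrier[OF U] U xc[OF ij(2)]]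
        adjoint_cols_of_mult[OF o] xc[OF ij(2)] by (simp add: w_def U_def)
    finally show "w i \<bullet>c w j = (if i = j then 1 else 0)"
      using orthonormal_familyD(2)[OF x(1) ij] by simp
  qed (use wc in auto)
  moreover have "real_eigenvectors A n w a"
    unfolding real_eigenvectors_def
  proof (intro allI impI)
    fix j assume j: "j < n"
    show "A *\<^sub>v w j = of_real (a j) \<cdot>\<^sub>v w j"
    proof (rule vec_eq_basisI[OF u])
      fix i assume i: "i < d"
      show "(A *\<^sub>v w j) \<bullet>c u i = (of_real (a j) \<cdot>\<^sub>v w j) \<bullet>c u i"
      \<comment> \<open>Off the block both sides vanish, the left one by \<open>inv\<close>; on it
        the equation is one coordinate of the eigenvector equation for \<open>C\<close>.\<close>
      proof (cases "i \<in> {p..<p + n}")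
        case False
        then show ?thesis
          using w_out[OF j i False] inv[OF _ i False] Aw_cs[OF j uc[OF i]] wc[OF j] uc[OF i] by simp
      next
        case True
        define l where "l = i - p"
        have l: "i = p + l" "l < n" using True by (auto simp: l_def)
        have "(A *\<^sub>v w j) \<bullet>c u i = (\<Sum>k<n. C $$ (l, k) * x j $ k)"
          unfolding Aw_cs[OF j uc[OF i]] using l by (intro sum.cong) (auto simp: C_def)
        also have "\<dots> = (C *\<^sub>v x j) $ l"
          using mult_mat_vec_sum[OF C xc[OF j] l(2)] by simp
        also have "\<dots> = of_real (a j) * x j $ l"
          using x(2) j l xc[OF j] unfolding real_eigenvectors_def by simp
        also have "\<dots> = (of_real (a j) \<cdot>\<^sub>v w j) \<bullet>c u i"
          using w_in[OF j l(2)] wc[OF j] uc[OF i] by (simp add: l(1))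
        finally show ?thesis .
      qed
    qed (use wc[OF j] A in auto)
  qed
  ultimately show ?thesis
    using w_out that by blast
qed

lemma hermitian_eigenpair:
  fixes A :: "complex mat"
  assumes A: "A \<in> carrier_mat n n" "mat_adjoint A = A" and "n > 0"
  obtains e r where "e \<in> carrier_vec n" "e \<bullet>c e = 1" "A *\<^sub>v e = of_real r \<cdot>\<^sub>v e"
proof -
  obtain as where as: "char_poly A = (\<Prod>a\<leftarrow>as. [:- a, 1:])" "length as = n"
    using char_poly_factorized[OF A(1)] by blast
  then obtain k as' where "as = k # as'"
    using \<open>n > 0\<close> by (cases as) auto
  then have "poly (char_poly A) k = 0"
    by (simp add: as)
  then obtain x where x: "x \<in> carrier_vec n" "x \<noteq> 0\<^sub>v n" "A *\<^sub>v x = k \<cdot>\<^sub>v x"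
    using A eigenvalue_root_char_poly[OF A(1)] by (auto simp: eigenvalue_def eigenvector_def)
  define n2 where "n2 = (\<Sum>a<n. (cmod (x $ a))\<^sup>2)"
  have xx: "x \<bullet>c x = of_real n2"
    using cscalar_self[OF x(1)] by (simp add: n2_def)
  have "n2 \<noteq> 0"
    using xx x conjugate_square_eq_0_vec[OF x(1)] by auto
  moreover have "n2 \<ge> 0"
    unfolding n2_def by (intro sum_nonneg) auto
  ultimately have pos: "n2 > 0" by simp
  have "k * (x \<bullet>c x) = (A *\<^sub>v x) \<bullet>c x"
    using x by simp
  also have "\<dots> = x \<bullet>c (A *\<^sub>v x)"
    using hermitian_cscalar[OF A x(1) x(1)] .
  also have "\<dots> = cnj k * (x \<bullet>c x)"
    using x by (simp add: conjugate_smult_vec)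
  finally have "k = cnj k"
    using xx pos by simp
  then have k: "k = of_real (Re k)"
    by (simp add: complex_eq_iff)
  define s where "s = complex_of_real (1 / sqrt n2)"
  have cs: "conjugate s = s" "s * (s * of_real n2) = 1"
    using pos by (simp_all add: s_def field_simps flip: of_real_mult)
  show ?thesis
  proof
    show "s \<cdot>\<^sub>v x \<in> carrier_vec n" using x by simp
    show "(s \<cdot>\<^sub>v x) \<bullet>c (s \<cdot>\<^sub>v x) = 1"
      using x(1) xx cs by (simp add: conjugate_smult_vec)
    show "A *\<^sub>v (s \<cdot>\<^sub>v x) = of_real (Re k) \<cdot>\<^sub>v (s \<cdot>\<^sub>v x)"
      using x A k by (simp add: mult_mat_vec[of _ n n] smult_smult_assoc mult_ac)
  qed
qed

text \<open>Deflation: a unit eigenvector \<open>e\<close> becomes vector \<open>0\<close> of a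
  basis, Hermitian symmetry makes the span of the other \<open>n\<close> vectors invariant, and the
  induction hypothesis applies to that block.\<close>

lemma hermitian_diagonalizable: "hermitian_diagonalizable n"
proof (induction n)
  case 0
  show ?case
    by (auto simp: hermitian_diagonalizable_def orthonormal_family_def real_eigenvectors_def)
next
  case (Suc n)
  show ?case
    unfolding hermitian_diagonalizable_def
  proof (intro ballI impI)
    fix A :: "complex mat" assume A: "A \<in> carrier_mat (Suc n) (Suc n)" "mat_adjoint A = A"
    obtain e r where e: "e \<in> carrier_vec (Suc n)" "e \<bullet>c e = 1" "A *\<^sub>v e = of_real r \<cdot>\<^sub>v e"
      using hermitian_eigenpair[OF A] by auto
    have "orthonormal_family (Suc n) 1 (\<lambda>_. e)"
      using e by (auto simp: orthonormal_family_def)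
    from extend_orthonormal_basis[OF this] obtain u
      where u: "orthonormal_family (Suc n) (Suc n) u" "u 0 = e"
      by auto
    have inv: "(A *\<^sub>v u (1 + k)) \<bullet>c u i = 0" if "k < n" "i < Suc n" "i \<notin> {1..<1 + n}" for k i
    proof -
      have [simp]: "i = 0" using that by auto
      have c: "u (1 + k) \<in> carrier_vec (Suc n)"
        using orthonormal_familyD(1)[OF u(1)] that by auto
      have "(A *\<^sub>v u (1 + k)) \<bullet>c u i = u (1 + k) \<bullet>c (of_real r \<cdot>\<^sub>v e)"
        using hermitian_cscalar[OF A c e(1)] u(2) e by simp
      also have "\<dots> = of_real r * (u (1 + k) \<bullet>c u 0)"
        using c e(1) u(2) by (simp add: conjugate_smult_vec)
      finally show ?thesis
        using orthonormal_familyD(2)[OF u(1), of "1 + k" 0] that by simp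
    qed
    obtain w a where w: "orthonormal_family (Suc n) n w" "real_eigenvectors A n w a"
      "\<And>k i. k < n \<Longrightarrow> i < Suc n \<Longrightarrow> i \<notin> {1..<1 + n} \<Longrightarrow> w k \<bullet>c u i = 0"
      using diagonalize_block[OF Suc A u(1) _ inv] by auto
    have we: "w k \<bullet>c e = 0" if "k < n" for k
      using w(3)[OF that, of 0] u(2) by simp
    have ew: "e \<bullet>c w k = 0" if "k < n" for k
      using cscalar_commute[OF orthonormal_familyD(1)[OF w(1) that] e(1)] we[OF that] by simp
    have "orthonormal_family (Suc n) (Suc n) (case_nat e w)"
      using orthonormal_familyD[OF w(1)] we ew e(1,2)
      by (auto simp: orthonormal_family_def split: nat.split)
    moreover have "real_eigenvectors A (Suc n) (case_nat e w) (case_nat r a)"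
      using w(2) e(3) by (auto simp: real_eigenvectors_def split: nat.split)
    ultimately show "\<exists>v a. orthonormal_family (Suc n) (Suc n) v \<and> real_eigenvectors A (Suc n) v a"
      by blast
  qed
qed

lemma sort_eigenvectors:
  assumes v: "orthonormal_family d n v" and a: "real_eigenvectors A n v a"
  obtains p l where "p permutes {..<n}" "length l = n" "sorted (rev l)"
    "orthonormal_family d n (v \<circ> p)" "real_eigenvectors A n (v \<circ> p) (nth l)"
proof -
  define l where "l = rev (sort (map a [0..<n]))"
  have "mset l = mset (map a [0..<n])" by (simp add: l_def)
  then obtain p where p: "p permutes {..<length (map a [0..<n])}" "permute_list p (map a [0..<n]) = l"
    by (rule mset_eq_permutation)
  then have p': "p permutes {..<n}" by simp
  have pn: "p i < n \<longleftrightarrow> i < n" for i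
    using permutes_in_image[OF p'] by auto
  have inj: "p i = p j \<longleftrightarrow> i = j" for i j
    using permutes_inj[OF p'] by (auto dest: injD)
  have l: "l ! i = a (p i)" if "i < n" for i
    using that p(2) permute_list_nth[OF p(1), of i] pn by simp
  show ?thesis
  proof
    show "orthonormal_family d n (v \<circ> p)"
      using v by (auto simp: orthonormal_family_def pn inj)
    show "real_eigenvectors A n (v \<circ> p) (nth l)"
      using a by (auto simp: real_eigenvectors_def pn l)
  qed (use p' in \<open>auto simp: l_def\<close>)
qed

lemma diagonalize_block_sorted:
  assumes A: "A \<in> carrier_mat d d" "mat_adjoint A = A"
    and u: "orthonormal_family d d u" and pn: "p + n \<le> d"
    and inv: "\<And>k i. k < n \<Longrightarrow> i < d \<Longrightarrow> i \<notin> {p..<p + n} \<Longrightarrow> (A *\<^sub>v u (p + k)) \<bullet>c u i = 0"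
  obtains w l where "orthonormal_family d n w" "length l = n" "sorted (rev l)"
    "real_eigenvectors A n w (nth l)"
    "\<And>k i. k < n \<Longrightarrow> i < d \<Longrightarrow> i \<notin> {p..<p + n} \<Longrightarrow> w k \<bullet>c u i = 0"
proof -
  obtain w a where w: "orthonormal_family d n w" "real_eigenvectors A n w a"
    "\<And>k i. k < n \<Longrightarrow> i < d \<Longrightarrow> i \<notin> {p..<p + n} \<Longrightarrow> w k \<bullet>c u i = 0"
    using diagonalize_block[OF hermitian_diagonalizable A u pn inv] by blast
  obtain q l where q: "q permutes {..<n}" "length l = n" "sorted (rev l)"
    "orthonormal_family d n (w \<circ> q)" "real_eigenvectors A n (w \<circ> q) (nth l)"
    using sort_eigenvectors[OF w(1,2)] by blast
  have "(w \<circ> q) k \<bullet>c u i = 0" if "k < n" "i < d" "i \<notin> {p..<p + n}" for k i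
    using w(3)[of "q k" i] that permutes_in_image[OF q(1), of k] by auto
  then show ?thesis using that[OF q(4,2,3,5)] by blast
qed

text \<open>The unitary matrix with columns \<open>v\<close> conjugates \<open>A\<close> to a
  diagonal matrix, so the roots of the characteristic polynomial are the entries of
  \<open>a\<close>. Since \<open>a\<close> may come in any order, spectra read off from different
  eigenbases can later be compared as multisets.\<close>

lemma eigvals_desc_eq:
  assumes A: "A \<in> carrier_mat d d" and v: "orthonormal_family d d v"
    and a: "real_eigenvectors A d v (nth a)" and "length a = d"
  shows "eigvals_desc A = rev (sort a)"
proof -
  define D :: "complex mat" where "D = mat d d (\<lambda>(i, j). if i = j then of_real (a ! i) else 0)"
  let ?U = "cols_of d d v"
  have D: "D \<in> carrier_mat d d" by (simp add: D_def)
  have U': "mat_adjoint ?U \<in> carrier_mat d d"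
    by (intro mat_adjoint_carrier) simp
  have "A * ?U = ?U * D"
  proof (rule mat_col_eqI)
    fix k assume "k < dim_col (?U * D)"
    then have k: "k < d" using D by simp
    have vk: "v k \<in> carrier_vec d" using orthonormal_familyD(1)[OF v k] .
    have "?U *\<^sub>v col D k = of_real (a ! k) \<cdot>\<^sub>v v k"
    proof (rule eq_vecI)
      fix i assume "i < dim_vec (of_real (a ! k) \<cdot>\<^sub>v v k)"
      then have i: "i < d" using vk by simp
      have "(?U *\<^sub>v col D k) $ i = (\<Sum>j<d. ?U $$ (i, j) * col D k $ j)"
        using i D by (intro mult_mat_vec_sum) auto
      also have "\<dots> = (\<Sum>j<d. if j = k then of_real (a ! k) * v k $ i else 0)"
        using i k by (intro sum.cong refl) (simp add: cols_of_def D_def)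
      finally show "(?U *\<^sub>v col D k) $ i = (of_real (a ! k) \<cdot>\<^sub>v v k) $ i"
        using i k vk by simp
    qed (use vk in auto)
    then show "col (A * ?U) k = col (?U * D) k"
      using A D k a vk
      by (simp add: col_mult2[of _ d d _ d] col_cols_of real_eigenvectors_def)
  qed (use A D in auto)
  then have "A = ?U * D * mat_adjoint ?U"
    using assoc_mult_mat[OF A _ U', of ?U] A cols_of_mult_adjoint[OF v] by simp
  then have "similar_mat A D"
    using A D U' cols_of_mult_adjoint[OF v] adjoint_cols_of_mult[OF v]
    by (intro similar_matI[of _ _ ?U "mat_adjoint ?U" d]) auto
  then have "char_poly A = char_poly D" by (rule char_poly_similar)
  also have "\<dots> = (\<Prod>x\<leftarrow>diag_mat D. [:- x, 1:])"
    by (rule char_poly_upper_triangular[OF D]) (auto simp: D_def)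
  also have "diag_mat D = map of_real a"
    using \<open>length a = d\<close> by (auto simp: diag_mat_def D_def intro!: nth_equalityI)
  finally have cp: "char_poly A = (\<Prod>x\<leftarrow>a. [:- of_real x, 1:])"
    by (simp add: o_def)
  have "proots (\<Prod>x\<leftarrow>xs. [:- complex_of_real x, 1:]) = image_mset of_real (mset xs)" for xs
  proof (induction xs)
    case (Cons x xs)
    have "(\<Prod>x\<leftarrow>xs. [:- complex_of_real x, 1:]) \<noteq> 0"
      by (auto simp: prod_list_zero_iff)
    then show ?case
      using Cons by (simp add: proots_mult del: mult_pCons_left)
  qed simp
  then have "image_mset Re (proots (char_poly A)) = mset a"
    by (simp add: cp image_mset.compositionality o_def)
  then show ?thesis
    by (simp add: eigvals_desc_def)
qed

lemma spectral_theorem: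
  assumes A: "A \<in> carrier_mat d d" "mat_adjoint A = A"
  obtains v where "orthonormal_family d d v" "real_eigenvectors A d v (nth (eigvals_desc A))"
proof -
  obtain w a where w: "orthonormal_family d d w" "real_eigenvectors A d w a"
    using hermitian_diagonalizable[of d] A unfolding hermitian_diagonalizable_def by blast
  obtain p l where q: "p permutes {..<d}" "length l = d" "sorted (rev l)"
    "orthonormal_family d d (w \<circ> p)" "real_eigenvectors A d (w \<circ> p) (nth l)"
    using sort_eigenvectors[OF w] by blast
  have "sort l = rev l"
    using q(3) by (metis mset_rev properties_for_sort)
  then show ?thesis
    using eigvals_desc_eq[OF A(1) q(4,5,2)] q that by simp
qed

lemma sorted_eigvals_desc: "sorted (rev (eigvals_desc A))"
  by (simp add: eigvals_desc_def)

section \<open>Quadratic forms in an eigenbasis\<close>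

lemma eigenbasis_cscalar:
  assumes A: "A \<in> carrier_mat d d" "mat_adjoint A = A" and v: "orthonormal_family d d v"
    and a: "real_eigenvectors A d v a" and x: "x \<in> carrier_vec d" and "i < d"
  shows "(A *\<^sub>v x) \<bullet>c v i = of_real (a i) * (x \<bullet>c v i)"
proof -
  have vi: "v i \<in> carrier_vec d" using orthonormal_familyD(1)[OF v \<open>i < d\<close>] .
  have "(A *\<^sub>v x) \<bullet>c v i = x \<bullet>c (of_real (a i) \<cdot>\<^sub>v v i)"
    using hermitian_cscalar[OF A x vi] a \<open>i < d\<close> by (simp add: real_eigenvectors_def)
  then show ?thesis using x vi by (simp add: conjugate_smult_vec)
qed

lemma quadratic_form_eigenbasis:
  assumes A: "A \<in> carrier_mat d d" "mat_adjoint A = A" and v: "orthonormal_family d d v"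
    and a: "real_eigenvectors A d v a" and x: "x \<in> carrier_vec d"
  shows "(A *\<^sub>v x) \<bullet>c x = of_real (\<Sum>l<d. a l * (cmod (x \<bullet>c v l))\<^sup>2)"
proof -
  have "A *\<^sub>v x \<in> carrier_vec d" using A x by simp
  then have "(A *\<^sub>v x) \<bullet>c x = (\<Sum>l<d. of_real (a l) * (x \<bullet>c v l) * cnj (x \<bullet>c v l))"
    by (simp add: parseval[OF v _ x] eigenbasis_cscalar[OF A v a x])
  also have "\<dots> = of_real (\<Sum>l<d. a l * (cmod (x \<bullet>c v l))\<^sup>2)"
    by (simp add: complex_norm_square mult_ac del: of_real_power)
  finally show ?thesis .
qed

text \<open>The support condition is a vanishing product because it typically arises from splitting
  a zero sum of nonnegative terms.\<close>

lemma eigenvector_if_supported: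
  assumes A: "A \<in> carrier_mat d d" "mat_adjoint A = A" and v: "orthonormal_family d d v"
    and a: "real_eigenvectors A d v a" and x: "x \<in> carrier_vec d"
    and supp: "\<And>l. l < d \<Longrightarrow> (c - a l) * (cmod (x \<bullet>c v l))\<^sup>2 = 0"
  shows "A *\<^sub>v x = of_real c \<cdot>\<^sub>v x"
proof (rule vec_eq_basisI[OF v])
  fix l assume l: "l < d"
  have "of_real (a l) * (x \<bullet>c v l) = of_real c * (x \<bullet>c v l)"
    using supp[OF l] by auto
  then show "(A *\<^sub>v x) \<bullet>c v l = (of_real c \<cdot>\<^sub>v x) \<bullet>c v l"
    using eigenbasis_cscalar[OF A v a x l] x orthonormal_familyD(1)[OF v l] by simp
qed (use A x in auto)

text \<open>The form of a unit vector is a weighted mean of the eigenvalues, and only eigenvalues at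
  most \<open>c\<close> carry weight. If the mean equals \<open>c\<close>, all the weight sits on
  the eigenvalue \<open>c\<close>.\<close>

lemma quadratic_form_le:
  assumes A: "A \<in> carrier_mat d d" "mat_adjoint A = A" and v: "orthonormal_family d d v"
    and a: "real_eigenvectors A d v a" and x: "x \<in> carrier_vec d" "x \<bullet>c x = 1"
    and supp: "\<And>l. l < d \<Longrightarrow> a l \<le> c \<or> x \<bullet>c v l = 0"
  shows "Re ((A *\<^sub>v x) \<bullet>c x) \<le> c"
    and "Re ((A *\<^sub>v x) \<bullet>c x) = c \<Longrightarrow> A *\<^sub>v x = of_real c \<cdot>\<^sub>v x"
proof -
  have "(\<Sum>l<d. (cmod (x \<bullet>c v l))\<^sup>2) = 1"
    using parseval_norm[OF v x(1)] x(2) by (metis of_real_eq_1_iff)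
  then have eq: "c - Re ((A *\<^sub>v x) \<bullet>c x) = (\<Sum>l<d. (c - a l) * (cmod (x \<bullet>c v l))\<^sup>2)"
    by (simp add: quadratic_form_eigenbasis[OF A v a x(1)] left_diff_distrib sum_subtractf
        flip: sum_distrib_left)
  have nonneg: "0 \<le> (c - a l) * (cmod (x \<bullet>c v l))\<^sup>2" if "l < d" for l
    using supp[OF that] by auto
  then have "0 \<le> (\<Sum>l<d. (c - a l) * (cmod (x \<bullet>c v l))\<^sup>2)"
    by (intro sum_nonneg) auto
  then show "Re ((A *\<^sub>v x) \<bullet>c x) \<le> c" using eq by simp
  assume "Re ((A *\<^sub>v x) \<bullet>c x) = c"
  then have "(\<Sum>l<d. (c - a l) * (cmod (x \<bullet>c v l))\<^sup>2) = 0" using eq by simp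
  then have "(c - a l) * (cmod (x \<bullet>c v l))\<^sup>2 = 0" if "l < d" for l
    using nonneg that by (subst (asm) sum_nonneg_eq_0_iff) auto
  then show "A *\<^sub>v x = of_real c \<cdot>\<^sub>v x"
    by (rule eigenvector_if_supported[OF A v a x(1)])
qed

text \<open>In an eigenbasis the form is a sum of nonnegative terms, so \<open>x\<close> has no
  component along an eigenvector of positive eigenvalue.\<close>

lemma psd_form_eq_0:
  assumes B: "B \<in> psd_mats d" and x: "x \<in> carrier_vec d" and 0: "Re ((B *\<^sub>v x) \<bullet>c x) = 0"
  shows "B *\<^sub>v x = 0\<^sub>v d"
proof -
  have A: "B \<in> carrier_mat d d" "mat_adjoint B = B"
    using B by (auto simp: psd_mats_def)
  obtain v where v: "orthonormal_family d d v" "real_eigenvectors B d v (nth (eigvals_desc B))"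
    using spectral_theorem[OF A] .
  let ?b = "nth (eigvals_desc B)"
  have nonneg: "0 \<le> ?b l" if "l < d" for l
  proof -
    note vl = orthonormal_familyD[OF v(1)]
    have "(B *\<^sub>v v l) \<bullet>c v l = of_real (?b l)"
      using eigenbasis_cscalar[OF A v vl(1)[OF that] that] vl(2)[OF that that] by simp
    then show ?thesis
      using B vl(1)[OF that] by (auto simp: psd_mats_def)
  qed
  have "(\<Sum>l<d. ?b l * (cmod (x \<bullet>c v l))\<^sup>2) = 0"
    using 0 quadratic_form_eigenbasis[OF A v x] by simp
  then have "?b l * (cmod (x \<bullet>c v l))\<^sup>2 = 0" if "l < d" for l
    using that nonneg by (subst (asm) sum_nonneg_eq_0_iff) auto
  then have "B *\<^sub>v x = of_real 0 \<cdot>\<^sub>v x"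
    by (intro eigenvector_if_supported[OF A v x]) auto
  then show ?thesis using x by (auto intro!: eq_vecI)
qed

section \<open>Ky Fan's inequality\<close>

lemma weighted_sum_le_initial_sum:
  fixes a P :: "nat \<Rightarrow> real"
  assumes anti: "\<And>i j. i \<le> j \<Longrightarrow> j < d \<Longrightarrow> a j \<le> a i"
    and P: "\<And>l. l < d \<Longrightarrow> 0 \<le> P l" "\<And>l. l < d \<Longrightarrow> P l \<le> 1"
    and sum: "(\<Sum>l<d. P l) = real k" and "k \<le> d"
  shows "(\<Sum>l<d. a l * P l) \<le> (\<Sum>l<k. a l)"
proof (cases "k = 0")
  case True
  then have "P l = 0" if "l < d" for l
    using sum P(1) that sum_nonneg_eq_0_iff[of "{..<d}" P] by simp
  then show ?thesis using True by simp
next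
  case False
  \<comment> \<open>The smallest of the \<open>k\<close> leading entries. Subtracting it changes
    both sides equally, because the weights sum to \<open>k\<close>, and makes the comparison
    termwise: the differences are nonnegative before \<open>k\<close> and nonpositive from there
    on.\<close>
  define \<tau> where "\<tau> = a (k - 1)"
  have "(\<Sum>l<d. (a l - \<tau>) * P l) \<le> (\<Sum>l<d. if l < k then a l - \<tau> else 0)"
  proof (intro sum_mono)
    fix l assume "l \<in> {..<d}"
    then have l: "l < d" by simp
    show "(a l - \<tau>) * P l \<le> (if l < k then a l - \<tau> else 0)"
    proof (cases "l < k")
      case True
      then have "\<tau> \<le> a l" unfolding \<tau>_def using False \<open>k \<le> d\<close> by (intro anti) auto
      then show ?thesis using True P(2)[OF l] by (simp add: mult_left_le)
    next
      case False
      then have "a l \<le> \<tau>" unfolding \<tau>_def using l by (intro anti) auto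
      then show ?thesis using False P(1)[OF l] by (simp add: mult_nonpos_nonneg)
    qed
  qed
  also have "\<dots> = (\<Sum>l<k. a l - \<tau>)"
  proof -
    have "{..<d} \<inter> {l. l < k} = {..<k}" using \<open>k \<le> d\<close> by auto
    then show ?thesis by (simp add: sum.If_cases)
  qed
  finally show ?thesis
    using sum by (simp add: left_diff_distrib sum_subtractf flip: sum_distrib_left)
qed

text \<open>The squared moduli of the entries \<open>u i \<bullet>c v l\<close> form a doubly
  stochastic matrix; summed over \<open>i\<close> in \<open>I\<close> they give weights at most
  \<open>1\<close> of total \<open>card I\<close>. The index set is arbitrary because a set with a
  gap, \<open>{..<l} \<union> {r..<d}\<close>, is needed later.\<close>

lemma ky_fan:
  assumes A: "A \<in> carrier_mat d d" "mat_adjoint A = A"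
    and u: "orthonormal_family d d u" and I: "I \<subseteq> {..<d}"
  shows "(\<Sum>i\<in>I. Re ((A *\<^sub>v u i) \<bullet>c u i)) \<le> (\<Sum>l<card I. eigvals_desc A ! l)"
proof -
  obtain v where v: "orthonormal_family d d v" "real_eigenvectors A d v (nth (eigvals_desc A))"
    using spectral_theorem[OF A] .
  let ?a = "nth (eigvals_desc A)"
  define P where "P l = (\<Sum>i\<in>I. (cmod (u i \<bullet>c v l))\<^sup>2)" for l
  have uc: "u i \<in> carrier_vec d" if "i < d" for i
    using orthonormal_familyD(1)[OF u that] .
  have "(\<Sum>i\<in>I. Re ((A *\<^sub>v u i) \<bullet>c u i)) = (\<Sum>i\<in>I. \<Sum>l<d. ?a l * (cmod (u i \<bullet>c v l))\<^sup>2)"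
    using I uc by (intro sum.cong refl) (auto simp: quadratic_form_eigenbasis[OF A v])
  also have "\<dots> = (\<Sum>l<d. ?a l * P l)"
    by (subst sum.swap) (simp add: P_def sum_distrib_left)
  also have "\<dots> \<le> (\<Sum>l<card I. ?a l)"
  proof (rule weighted_sum_le_initial_sum)
    show "?a j \<le> ?a i" if "i \<le> j" "j < d" for i j
      using that sorted_eigvals_desc[of A] length_eigvals_desc[OF A(1)]
      by (simp add: sorted_rev_iff_nth_mono)
    show "0 \<le> P l" for l
      by (simp add: P_def sum_nonneg)
    show "P l \<le> 1" if l: "l < d" for l
    proof -
      note vl = orthonormal_familyD[OF v(1)]
      have "P l \<le> (\<Sum>i<d. (cmod (u i \<bullet>c v l))\<^sup>2)"
        unfolding P_def using I by (intro sum_mono2) auto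
      also have "\<dots> = (\<Sum>i<d. (cmod (v l \<bullet>c u i))\<^sup>2)"
        using uc vl(1)[OF l] by (intro sum.cong refl) (simp add: cscalar_commute[of "v l" d])
      also have "\<dots> = 1"
        using parseval_norm[OF u vl(1)[OF l]] vl(2)[OF l l] by (metis of_real_eq_1_iff)
      finally show ?thesis .
    qed
    have "(\<Sum>l<d. P l) = (\<Sum>i\<in>I. \<Sum>l<d. (cmod (u i \<bullet>c v l))\<^sup>2)"
      unfolding P_def by (rule sum.swap)
    also have "\<dots> = (\<Sum>i\<in>I. 1)"
    proof (intro sum.cong refl)
      fix i assume "i \<in> I"
      then have i: "i < d" using I by auto
      show "(\<Sum>l<d. (cmod (u i \<bullet>c v l))\<^sup>2) = 1"
        using parseval_norm[OF v(1) uc[OF i]] orthonormal_familyD(2)[OF u i i]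
        by (metis of_real_eq_1_iff)
    qed
    finally show "(\<Sum>l<d. P l) = real (card I)" by simp
    show "card I \<le> d"
      using card_mono[OF _ I] by simp
  qed
  finally show ?thesis .
qed

section \<open>The trace in an orthonormal basis\<close>

lemma trace_eq_sum_forms:
  assumes A: "A \<in> carrier_mat d d" and u: "orthonormal_family d d u"
  shows "mat_trace A = (\<Sum>i<d. (A *\<^sub>v u i) \<bullet>c u i)"
proof -
  let ?U = "cols_of d d u"
  have uc: "u i \<in> carrier_vec d" if "i < d" for i
    using orthonormal_familyD(1)[OF u that] .
  \<comment> \<open>The rows of the unitary matrix are orthonormal as well, which collapses the
    double sum to the diagonal.\<close>
  have UU: "(\<Sum>i<d. u i $ b * cnj (u i $ a)) = (if a = b then 1 else 0)" if "a < d" "b < d" for a b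
  proof -
    have "(\<Sum>i<d. u i $ b * cnj (u i $ a)) = (?U * mat_adjoint ?U) $$ (b, a)"
      using that by (auto simp: scalar_prod_def atLeast0LessThan index_mat_adjoint intro!: sum.cong)
        (simp add: cols_of_def)
    then show ?thesis using that by (simp add: cols_of_mult_adjoint[OF u])
  qed
  have "(\<Sum>i<d. (A *\<^sub>v u i) \<bullet>c u i) = (\<Sum>i<d. \<Sum>a<d. \<Sum>b<d. A $$ (a, b) * (u i $ b * cnj (u i $ a)))"
  proof (intro sum.cong refl)
    fix i assume "i \<in> {..<d}"
    then have i: "u i \<in> carrier_vec d" using uc by simp
    show "(A *\<^sub>v u i) \<bullet>c u i = (\<Sum>a<d. \<Sum>b<d. A $$ (a, b) * (u i $ b * cnj (u i $ a)))"
      unfolding cscalar_sum[OF i]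
      using A i by (simp add: mult_mat_vec_sum[OF A i] sum_distrib_left mult_ac del: index_mult_mat_vec)
  qed
  also have "\<dots> = (\<Sum>a<d. \<Sum>b<d. \<Sum>i<d. A $$ (a, b) * (u i $ b * cnj (u i $ a)))"
    by (subst sum.swap, subst (2) sum.swap) (rule refl)
  also have "\<dots> = (\<Sum>a<d. \<Sum>b<d. if a = b then A $$ (a, b) else 0)"
    by (intro sum.cong refl) (simp add: UU flip: sum_distrib_left)
  also have "\<dots> = mat_trace A"
    using A by (simp add: mat_trace_def)
  finally show ?thesis ..
qed

lemma trace_eq_sum_eigvals:
  assumes A: "A \<in> carrier_mat d d" "mat_adjoint A = A"
  shows "mat_trace A = of_real (\<Sum>i<d. eigvals_desc A ! i)"
proof -
  obtain v where v: "orthonormal_family d d v" "real_eigenvectors A d v (nth (eigvals_desc A))"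
    using spectral_theorem[OF A] .
  have "(A *\<^sub>v v i) \<bullet>c v i = of_real (eigvals_desc A ! i)" if "i < d" for i
    using eigenbasis_cscalar[OF A v _ that] orthonormal_familyD[OF v(1)] that by simp
  then show ?thesis
    by (simp add: trace_eq_sum_forms[OF A(1) v(1)])
qed

section \<open>Sums of rank-one matrices\<close>

lemma spectral_sum_mult_basis:
  assumes v: "orthonormal_family d d v" and I: "I \<subseteq> {..<d}" and "k < d"
  shows "spectral_sum d I g v *\<^sub>v v k = of_real (if k \<in> I then g k else 0) \<cdot>\<^sub>v v k"
proof (rule vec_eq_basisI[OF v])
  note vD = orthonormal_familyD[OF v]
  have fin: "finite I" using I finite_subset by blast
  fix i assume i: "i < d"
  have "(spectral_sum d I g v *\<^sub>v v k) \<bullet>c v i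
      = (\<Sum>l\<in>I. of_real (g l) * (v k \<bullet>c v l) * cnj (v i \<bullet>c v l))"
    using I vD(1) i \<open>k < d\<close> by (intro spectral_sum_cscalar) auto
  also have "\<dots> = (\<Sum>l\<in>I. if l = k then of_real (g k) * (v k \<bullet>c v i) else 0)"
    using I vD(2) i \<open>k < d\<close> by (intro sum.cong refl) auto
  also have "\<dots> = (of_real (if k \<in> I then g k else 0) \<cdot>\<^sub>v v k) \<bullet>c v i"
    using vD(1)[OF i] vD(1)[OF \<open>k < d\<close>] fin by simp
  finally show "(spectral_sum d I g v *\<^sub>v v k) \<bullet>c v i
      = (of_real (if k \<in> I then g k else 0) \<cdot>\<^sub>v v k) \<bullet>c v i" .
qed (use orthonormal_familyD(1)[OF v \<open>k < d\<close>] in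
    \<open>auto intro: mult_mat_vec_carrier[OF spectral_sum_carrier]\<close>)

lemma spectral_sum_psd:
  assumes "\<And>i. i \<in> I \<Longrightarrow> v i \<in> carrier_vec d" "\<And>i. i \<in> I \<Longrightarrow> 0 \<le> g i"
  shows "spectral_sum d I g v \<in> psd_mats d"
proof -
  have "0 \<le> Re ((spectral_sum d I g v *\<^sub>v x) \<bullet>c x)" if x: "x \<in> carrier_vec d" for x
  proof -
    have "(spectral_sum d I g v *\<^sub>v x) \<bullet>c x
        = (\<Sum>i\<in>I. of_real (g i) * (x \<bullet>c v i) * cnj (x \<bullet>c v i))"
      using assms(1) x by (intro spectral_sum_cscalar)
    also have "\<dots> = of_real (\<Sum>i\<in>I. g i * (cmod (x \<bullet>c v i))\<^sup>2)"
      by (simp add: complex_norm_square mult_ac del: of_real_power)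
    finally show ?thesis
      using assms(2) by (simp add: sum_nonneg)
  qed
  then show ?thesis by (simp add: psd_mats_def adjoint_spectral_sum)
qed

text \<open>The sum in the theorem is taken in the additive group of matrices, where each summand
  must be shown to lie in the carrier; this translation removes that burden and the index shift by
  \<open>r\<close>.\<close>

lemma finsum_rank_one_eq_spectral_sum:
  assumes v: "\<And>i. i < n \<Longrightarrow> v (r + i) \<in> carrier_vec d"
  shows "(\<Oplus>\<^bsub>module_mat TYPE(complex) d d\<^esub>i\<in>{0..<n}.
      complex_of_real (g (r + i)) \<cdot>\<^sub>m rank_one (v (r + i)) (v (r + i)))
    = spectral_sum d {r..<r + n} g v"
  using v
proof (induction n)
  interpret abelian_group "module_mat TYPE(complex) d d" by (rule abelian_group_mat)
  case 0
  show ?case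
    by (auto simp: spectral_sum_def module_mat_simps intro!: eq_matI)
next
  interpret abelian_group "module_mat TYPE(complex) d d" by (rule abelian_group_mat)
  case (Suc n)
  let ?f = "\<lambda>i. complex_of_real (g (r + i)) \<cdot>\<^sub>m rank_one (v (r + i)) (v (r + i))"
  have f: "?f i \<in> carrier_mat d d" if "i \<le> n" for i
    using Suc.prems[of i] that by (simp add: rank_one_def)
  have "(\<Oplus>\<^bsub>module_mat TYPE(complex) d d\<^esub>i\<in>insert n {0..<n}. ?f i)
      = ?f n + (\<Oplus>\<^bsub>module_mat TYPE(complex) d d\<^esub>i\<in>{0..<n}. ?f i)"
    using f finsum_insert[of "{0..<n}" n ?f] by (auto simp: module_mat_simps)
  moreover have "{0..<Suc n} = insert n {0..<n}" by auto
  moreover have "?f n + spectral_sum d {r..<r + n} g v = spectral_sum d {r..<r + Suc n} g v"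
    using Suc.prems[of n] by (intro eq_matI) (auto simp: rank_one_def spectral_sum_def)
  ultimately show ?case
    using Suc by simp
qed

lemma orthonormal_basis_iff: "orthonormal_basis d v \<longleftrightarrow> orthonormal_family d d v"
proof -
  interpret vec_space "TYPE(complex)" d .
  show ?thesis
  proof
    assume "orthonormal_basis d v"
    then have "v ` {..<d} \<subseteq> carrier_vec d"
        "\<forall>i<d. \<forall>j<d. v i \<bullet>c v j = (if i = j then 1 else 0)"
      by (auto simp: orthonormal_basis_def basis_def)
    then show "orthonormal_family d d v"
      by (auto simp: orthonormal_family_def)
  next
    assume v: "orthonormal_family d d v"
    let ?U = "cols_of d d v"
    have "cols ?U = map v [0..<d]"
      using orthonormal_familyD(1)[OF v] by (auto simp: cols_def col_cols_of)
    then have set: "set (cols ?U) = v ` {..<d}" by (auto simp: atLeast0LessThan)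
    have "det ?U * det (mat_adjoint ?U) = 1"
      using det_mult[of ?U d "mat_adjoint ?U"] mat_adjoint_carrier[of ?U d d]
      by (simp add: cols_of_mult_adjoint[OF v])
    then have "det ?U \<noteq> 0" by auto
    then have li: "\<not> lin_dep (v ` {..<d})"
      using lin_dep_cols_imp_det_0[of ?U] set by auto
    have inj: "inj_on v {..<d}"
    proof (rule inj_onI)
      fix i j assume "i \<in> {..<d}" "j \<in> {..<d}" "v i = v j"
      then show "i = j"
        using orthonormal_familyD(2)[OF v, of i j] orthonormal_familyD(2)[OF v, of j j]
        by (auto split: if_splits)
    qed
    have "basis (v ` {..<d})"
      using li orthonormal_familyD(1)[OF v] inj
      by (intro dim_li_is_basis) (auto simp: dim_is_n card_image)
    then show "orthonormal_basis d v"
      using orthonormal_familyD(2)[OF v] by (auto simp: orthonormal_basis_def)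
  qed
qed

lemma orthonormal_eigenbasis_iff:
  "orthonormal_eigenbasis d A a v \<longleftrightarrow> orthonormal_family d d v \<and> real_eigenvectors A d v (nth a)"
  by (simp add: orthonormal_eigenbasis_def orthonormal_basis_iff real_eigenvectors_def)

section \<open>The parameters\<close>

text \<open>All that the spectral part uses about the parameters, with \<open>j\<close> in the role
  of \<open>r_val_m\<close> and \<open>r\<close> in that of \<open>r'\<close>. The alternative
  \<open>j = r\<close> or \<open>int r = m\<close> separates plain water-filling from the case in
  which the rank bound keeps the entries \<open>j, ..., m - 1\<close> from being raised. The last
  equation fixes the trace.\<close>

definition water_level :: "real list \<Rightarrow> int \<Rightarrow> real \<Rightarrow> nat \<Rightarrow> nat \<Rightarrow> real \<Rightarrow> bool" where
  "water_level lam m t j r c \<longleftrightarrow> j \<le> r \<and> r < length lam \<and> (j = r \<or> int r = m) \<and> m \<le> int r \<and>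
     (\<forall>i<j. c < lam ! i) \<and> (\<forall>i. j \<le> i \<longrightarrow> i < length lam \<longrightarrow> lam ! i \<le> c) \<and>
     (\<Sum>i<r. lam ! i) + (real (length lam) - real r) * c = t"

lemma sorted_rev_nth_mono:
  fixes lam :: "real list"
  shows "sorted (rev lam) \<Longrightarrow> i \<le> j \<Longrightarrow> j < length lam \<Longrightarrow> lam ! j \<le> lam ! i"
  by (simp add: sorted_rev_iff_nth_mono)

lemma r_val_c_val:
  fixes lam :: "real list"
  assumes srt: "sorted (rev lam)" and "lam \<noteq> []" and t: "(\<Sum>i<length lam. lam ! i) \<le> t"
  defines "d \<equiv> length lam"
  shows "r_val lam t < d"
    and "i < r_val lam t \<Longrightarrow> c_val lam t < lam ! i"
    and "r_val lam t \<le> i \<Longrightarrow> i < d \<Longrightarrow> lam ! i \<le> c_val lam t"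
    and "(\<Sum>i<r_val lam t. lam ! i) + (real d - real (r_val lam t)) * c_val lam t = t"
proof -
  define R where "R = {r \<in> {0..<d}. p_val lam r t \<ge> lam ! r}"
  define r where "r = r_val lam t"
  have r: "r = Min R" by (simp add: r_def r_val_def R_def d_def)
  have d: "d > 0" using \<open>lam \<noteq> []\<close> by (simp add: d_def)
  have fin: "finite R" by (simp add: R_def)
  \<comment> \<open>Because \<open>t\<close> is at least the trace, \<open>d - 1\<close> is
    admissible and the minimum is taken over a nonempty set.\<close>
  have "(\<Sum>i<d - 1. lam ! i) + lam ! (d - 1) = (\<Sum>i<d. lam ! i)"
    using sum.lessThan_Suc[of "nth lam" "d - 1"] d by simp
  then have "lam ! (d - 1) \<le> t - (\<Sum>i<d - 1. lam ! i)"
    using t unfolding d_def by linarith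
  then have "d - 1 \<in> R"
    using d by (simp add: R_def p_val_def of_nat_diff flip: d_def)
  then have "r \<in> R" using Min_in[OF fin] by (auto simp: r)
  then have rd: "r < d" and pr: "lam ! r \<le> p_val lam r t" by (auto simp: R_def)
  define c where "c = c_val lam t"
  have c: "c = p_val lam r t" by (simp add: c_def c_val_def r_def)
  have sum: "(\<Sum>i<r. lam ! i) + (real d - real r) * c = t"
    using rd by (simp add: c p_val_def flip: d_def)
  show "r_val lam t < d" using rd by (simp add: r_def)
  show "(\<Sum>i<r_val lam t. lam ! i) + (real d - real (r_val lam t)) * c_val lam t = t"
    using sum by (simp add: r_def c_def)
  show "lam ! i \<le> c_val lam t" if "r_val lam t \<le> i" "i < d"
    using sorted_rev_nth_mono[OF srt, of r i] that pr by (simp add: r_def c_def[symmetric] c d_def)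
  show "c_val lam t < lam ! i" if "i < r_val lam t"
  proof -
    \<comment> \<open>The predecessor \<open>s\<close> of \<open>r\<close> is inadmissible:
      \<open>t\<close> minus the first \<open>s\<close> entries is less than
      \<open>(d - s) * lam ! s\<close>. Subtracting \<open>lam ! s\<close> on both sides turns the
      left one into \<open>(d - r) * c\<close>.\<close>
    define s where "s = r - 1"
    have s: "r = Suc s" "i \<le> s" using that by (auto simp: s_def r_def)
    have "s \<notin> R"
      using Min_le[OF fin, of s] s by (auto simp: r)
    then have "p_val lam s t < lam ! s"
      using s rd by (auto simp: R_def)
    moreover have "real d - real s > 0" using rd s by simp
    ultimately have "t - (\<Sum>i<s. lam ! i) < lam ! s * (real d - real s)"
      by (simp add: p_val_def pos_divide_less_eq flip: d_def)
    then have "(real d - real r) * c < (real d - real r) * lam ! s"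
      using sum by (simp add: s algebra_simps)
    then have "c < lam ! s" using rd by simp
    also have "\<dots> \<le> lam ! i" using sorted_rev_nth_mono[OF srt s(2)] s rd by (simp add: d_def)
    finally show ?thesis by (simp add: c_def)
  qed
qed

lemma water_level_params:
  fixes lam :: "real list"
  assumes srt: "sorted (rev lam)" and "lam \<noteq> []" and t: "(\<Sum>i<length lam. lam ! i) \<le> t"
    and m: "m < int (length lam)"
  shows "water_level lam m t (r_val_m lam m t) (nat (max (int (r_val_m lam m t)) m)) (c_val_m lam m t)"
proof -
  define d where "d = length lam"
  define r where "r = r_val lam t"
  note rc = r_val_c_val[OF assms(1-3), folded d_def r_def]
  consider "m \<le> 0" | "m \<ge> 1" "t \<le> s_star lam (nat m)" | "m \<ge> 1" "t > s_star lam (nat m)"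
    by linarith
  then show ?thesis
  proof cases
    case 1
    then have "nat (max (int r) m) = r" by simp
    then show ?thesis
      using rc 1 by (simp add: water_level_def r_val_m_def c_val_m_def r_def d_def)
  next
    case 2
    define n where "n = nat m"
    have n: "int n = m" "1 \<le> n" "n < d" using 2 m by (auto simp: n_def d_def)
    define c where "c = c_val lam t"
    have c: "c_val_m lam m t = c" using 2 by (simp add: c_val_m_def c_def)
    have "Min {i \<in> {0..<length lam}. c \<ge> lam ! i} = r"
    proof (rule Min_eqI)
      fix i assume "i \<in> {i \<in> {0..<length lam}. c \<ge> lam ! i}"
      then show "r \<le> i" using rc(2)[of i] by (auto simp: c_def not_less[symmetric])
    qed (use rc in \<open>auto simp: c_def d_def\<close>)
    then have j: "r_val_m lam m t = r" using 2 by (simp add: r_val_m_def c)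
    show ?thesis
    proof (cases "n \<le> r")
      case True
      then have "nat (max (int r) m) = r" using n by simp
      then show ?thesis
        using rc True n by (simp add: water_level_def j c c_def d_def)
    next
      \<comment> \<open>Here \<open>c\<close> was computed with \<open>r < n\<close>, while the
        trace equation is needed with \<open>n\<close>. The two differ by \<open>(n - r) * c\<close>
        minus the entries \<open>r, ..., n - 1\<close>, which is nonnegative by \<open>1\<close>.
        The bound on \<open>t\<close> together with \<open>2\<close> shows that it is also
        nonpositive, so these entries all equal \<open>c\<close>.\<close>
      case False
      then have r': "nat (max (int r) m) = n" using n by simp
      have split: "(\<Sum>i<n. lam ! i) = (\<Sum>i<r. lam ! i) + (\<Sum>i\<in>{r..<n}. lam ! i)"
        using False by (simp add: sum.atLeastLessThan_concat lessThan_atLeast0)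
      have "0 \<le> (\<Sum>i\<in>{r..<n}. c - lam ! i)"
        using rc(3) n by (intro sum_nonneg) (auto simp: c_def)
      then have 1: "0 \<le> (real n - real r) * c - (\<Sum>i\<in>{r..<n}. lam ! i)"
        using False by (simp add: sum_subtractf of_nat_diff)
      have "lam ! (n - 1) \<le> c" using rc(3)[of "n - 1"] False n by (simp add: c_def)
      then have 2: "0 \<le> (real d - real n) * (c - lam ! (n - 1))"
        using n by simp
      have "t \<le> (\<Sum>i<n. lam ! i) + (real d - real n) * lam ! (n - 1)"
        using \<open>t \<le> s_star lam (nat m)\<close> by (simp add: s_star_def n_def d_def)
      then have "(\<Sum>i<n. lam ! i) + (real d - real n) * c = t"
        using rc(4) 1 2 split by (simp add: algebra_simps flip: c_def)
      then show ?thesis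
        using rc(2,3) False n unfolding j c r' water_level_def by (simp add: c_def d_def)
    qed
  next
    case 3
    define n where "n = nat m"
    have n: "int n = m" "1 \<le> n" "n < d" using 3 m by (auto simp: n_def d_def)
    define c where "c = c_val_m lam m t"
    have c: "c = lam ! (n - 1) + (t - s_star lam n) / (real d - real n)"
      using 3 by (simp add: c_val_m_def c_def n_def d_def)
    \<comment> \<open>Beyond \<open>s_star\<close> the level exceeds \<open>lam ! (n - 1)\<close>.
      Hence \<open>n - 1\<close> is already admissible, the minimum \<open>j\<close> is below
      \<open>n\<close>, and \<open>n\<close> is the larger of the two.\<close>
    have "lam ! (n - 1) < c" using 3 n by (simp add: c flip: n_def)
    define R where "R = {i \<in> {0..<length lam}. c \<ge> lam ! i}"
    define j where "j = Min R"
    have j: "r_val_m lam m t = j" using 3 by (simp add: r_val_m_def j_def R_def c_def)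
    have R: "finite R" "n - 1 \<in> R" using \<open>lam ! (n - 1) < c\<close> n by (auto simp: R_def d_def)
    have "j \<in> R" using Min_in[OF R(1)] R(2) unfolding j_def by blast
    have jn: "j < n" using Min_le[OF R] n by (simp add: j_def)
    then have r': "nat (max (int j) m) = n" using n by simp
    have "c < lam ! i" if "i < j" for i
    proof -
      have "i \<notin> R" using Min_le[OF R(1), of i] that by (auto simp: j_def)
      moreover have "i < length lam" using that \<open>j \<in> R\<close> by (simp add: R_def)
      ultimately show ?thesis by (simp add: R_def)
    qed
    moreover have "lam ! i \<le> c" if "j \<le> i" "i < d" for i
      using sorted_rev_nth_mono[OF srt that(1)] that \<open>j \<in> R\<close> by (simp add: R_def d_def)
    moreover have "(\<Sum>i<n. lam ! i) + (real d - real n) * c = t"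
      using n by (simp add: c s_star_def distrib_left flip: d_def)
    ultimately show ?thesis
      using jn n unfolding j r' c_def[symmetric] water_level_def by (simp add: d_def)
  qed
qed

text \<open>In the three cases in which the minimizer is unique, the coefficients \<open>c - \<lambda>\<^sub>i\<close> for \<open>i \<ge> r\<close>
  and \<open>0\<close> for \<open>i < r\<close> depend on \<open>\<lambda>\<^sub>i\<close> only.\<close>

lemma water_level_separated:
  fixes lam :: "real list"
  assumes w: "water_level lam m t j r c" and srt: "sorted (rev lam)"
    and "m \<le> 0 \<or> (m \<ge> 1 \<and> lam ! (nat m - 1) > lam ! nat m) \<or>
     (m \<ge> 1 \<and> lam ! (nat m - 1) = lam ! nat m \<and> t \<le> s_star lam (nat m))"
    and ik: "i < r" "r \<le> k" "k < length lam" and eq: "lam ! i = lam ! k"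
  shows "lam ! k = c"
proof (cases "j = r")
  case True
  \<comment> \<open>Contradictory assumptions: \<open>lam ! k \<le> c < lam ! i\<close>.\<close>
  then show ?thesis using w ik eq by (force simp: water_level_def)
next
  case False
  then have r: "int r = m" "r < length lam" using w by (auto simp: water_level_def)
  then have m: "nat m = r" "m \<ge> 1" using ik by auto
  have kc: "lam ! k \<le> c" using w ik by (auto simp: water_level_def)
  have 1: "lam ! (r - 1) \<le> lam ! i" "lam ! k \<le> lam ! r"
    using sorted_rev_nth_mono[OF srt] ik r by simp_all
  \<comment> \<open>Equal entries on both sides of position \<open>r = m\<close> force
    \<open>lam ! (m - 1) = lam ! m\<close>, so the strict gap is excluded and the remaining
    alternative bounds \<open>t\<close>. By the trace equation this bound pushes \<open>c\<close>
    down to \<open>lam ! (r - 1)\<close>.\<close>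
  then have "t \<le> s_star lam r" using assms(3) eq m by auto
  moreover have "(\<Sum>i<r. lam ! i) + (real (length lam) - real r) * c = t"
    using w by (simp add: water_level_def)
  ultimately have "(real (length lam) - real r) * c \<le> (real (length lam) - real r) * lam ! (r - 1)"
    unfolding s_star_def by linarith
  then have "c \<le> lam ! (r - 1)" using r by simp
  then show ?thesis using 1 kc eq by simp
qed

section \<open>The minimal vector\<close>

text \<open>The decreasing rearrangement of \<open>take r lam\<close> followed by
  \<open>length lam - r\<close> copies of \<open>c\<close>: the first \<open>j\<close> entries
  exceed \<open>c\<close>, the others among the first \<open>r\<close> are at most \<open>c\<close>
  and move behind the copies. For \<open>j = r\<close> the last block is empty.\<close>

definition water_fill :: "real list \<Rightarrow> nat \<Rightarrow> nat \<Rightarrow> real \<Rightarrow> real list" where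
  "water_fill lam j r c = take j lam @ replicate (length lam - r) c @ drop j (take r lam)"

lemma length_water_fill: "j \<le> r \<Longrightarrow> r < length lam \<Longrightarrow> length (water_fill lam j r c) = length lam"
  by (simp add: water_fill_def)

lemma mset_water_fill:
  assumes "j \<le> r"
  shows "mset (water_fill lam j r c) = mset (take r lam @ replicate (length lam - r) c)"
proof -
  have "take j lam @ drop j (take r lam) = take r lam"
    using assms append_take_drop_id[of j "take r lam"] by (simp add: min_def)
  then have "mset (take j lam) + mset (drop j (take r lam)) = mset (take r lam)"
    by (metis mset_append)
  then show ?thesis by (simp add: water_fill_def)
qed

lemma sorted_water_fill:
  assumes w: "water_level lam m t j r c" and srt: "sorted (rev lam)"
  shows "sorted (rev (water_fill lam j r c))"
proof -
  have s: "sorted_wrt (\<ge>) lam" using srt by (simp add: sorted_wrt_rev)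
  have w': "j \<le> r" "r < length lam" "\<And>i. i < j \<Longrightarrow> c < lam ! i"
    "\<And>i. j \<le> i \<Longrightarrow> i < length lam \<Longrightarrow> lam ! i \<le> c"
    using w by (auto simp: water_level_def)
  have 1: "c \<le> x" if "x \<in> set (take j lam)" for x
    using that w' by (force simp: in_set_conv_nth)
  have 2: "x \<le> c" if x: "x \<in> set (drop j (take r lam))" for x
  proof -
    obtain i where "i < r - j" "x = lam ! (j + i)"
      using x w' by (auto simp: in_set_conv_nth)
    then show ?thesis using w' by auto
  qed
  have 3: "sorted_wrt (\<ge>) (take j lam)" "sorted_wrt (\<ge>) (drop j (take r lam))"
    using s by (auto intro: sorted_wrt_take sorted_wrt_drop)
  have "sorted_wrt (\<ge>) (water_fill lam j r c)"
    unfolding water_fill_def sorted_wrt_append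
    using 1 2 3 by (force simp: sorted_wrt_iff_nth_less[of _ "replicate _ _"])
  then show ?thesis by (simp add: sorted_wrt_rev)
qed

lemma sort_eq_rev_if_sorted: "sorted (rev xs) \<Longrightarrow> sort xs = rev xs"
  by (metis mset_rev properties_for_sort)

lemma rev_sort_eqI: "mset xs = mset ys \<Longrightarrow> sorted (rev ys) \<Longrightarrow> rev (sort xs) = ys"
  by (metis mset_rev properties_for_sort rev_rev_ident)

lemma sum_water_fill_le:
  assumes "j \<le> r" "r < length lam" "k \<le> j"
  shows "(\<Sum>i<k. water_fill lam j r c ! i) = (\<Sum>i<k. lam ! i)"
  using assms by (intro sum.cong) (auto simp: water_fill_def nth_append)

lemma sum_water_fill_plus:
  assumes "j \<le> r" "r < length lam" "k \<le> length lam - r"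
  shows "(\<Sum>i<j + k. water_fill lam j r c ! i) = (\<Sum>i<j. lam ! i) + real k * c"
  using assms(3)
proof (induction k)
  case 0
  then show ?case using sum_water_fill_le[OF assms(1,2), of j c] by simp
next
  case (Suc k)
  have "water_fill lam j r c ! (j + k) = c"
    using assms Suc.prems by (simp add: water_fill_def nth_append)
  then show ?case using Suc by (simp add: algebra_simps)
qed

text \<open>Past the plateau, partial sums are indexed by the number \<open>l\<close> of entries of
  \<open>lam\<close> that they contain; this is the form in which Ky Fan's inequality delivers its
  lower bounds.\<close>

lemma sum_water_fill_ge:
  assumes "j \<le> r" "r < length lam" "j \<le> l" "l \<le> r"
  shows "(\<Sum>i<length lam - r + l. water_fill lam j r c ! i)
    = (\<Sum>i<l. lam ! i) + (real (length lam) - real r) * c"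
  using assms(3,4)
proof (induction l rule: dec_induct)
  case base
  then show ?case
    using sum_water_fill_plus[OF assms(1,2), of "length lam - r" c] assms
    by (simp add: add.commute of_nat_diff)
next
  case (step n)
  let ?q = "length lam - r"
  have "?q + n = length (take j lam @ replicate ?q c) + (n - j)"
    using step.hyps assms by simp
  moreover have "((take j lam @ replicate ?q c) @ drop j (take r lam)) !
      (length (take j lam @ replicate ?q c) + (n - j)) = drop j (take r lam) ! (n - j)"
    by (rule nth_append_length_plus)
  moreover have "drop j (take r lam) ! (n - j) = lam ! n"
    using step.hyps step.prems assms by simp
  ultimately have "water_fill lam j r c ! (?q + n) = lam ! n"
    by (simp only: water_fill_def append_assoc)
  then have "(\<Sum>i<Suc (length lam - r + n). water_fill lam j r c ! i)
      = (\<Sum>i<length lam - r + n. water_fill lam j r c ! i) + lam ! n"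
    by simp
  then show ?case using step by simp
qed

lemma sum_water_fill:
  assumes w: "water_level lam m t j r c"
  shows "(\<Sum>i<length lam. water_fill lam j r c ! i) = t"
  using w sum_water_fill_ge[of j r lam r c] by (simp add: water_level_def)

text \<open>Between \<open>j\<close> and \<open>j + (d - r)\<close> the partial sums of the minimal vector are linear, while those
  of a decreasing vector are concave; so it suffices to compare them outside of this interval.\<close>

lemma water_fill_majorized:
  assumes w: "water_level lam m t j r c" and srt: "sorted (rev lam)"
    and mu: "sorted (rev mu)" "length mu = length lam"
    and low: "\<And>k. k \<le> j \<Longrightarrow> (\<Sum>i<k. lam ! i) \<le> (\<Sum>i<k. mu ! i)"
    and high: "\<And>l. j \<le> l \<Longrightarrow> l \<le> r \<Longrightarrow>
      (\<Sum>i<l. lam ! i) + (real (length lam) - real r) * c \<le> (\<Sum>i<length lam - r + l. mu ! i)"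
  shows "water_fill lam j r c \<prec>\<^sub>w mu"
proof -
  define d where "d = length lam"
  let ?nu = "water_fill lam j r c"
  have jr: "j \<le> r" "r < d" using w by (auto simp: water_level_def d_def)
  have "(\<Sum>i<k. ?nu ! i) \<le> (\<Sum>i<k. mu ! i)" if "k \<le> d" for k
  proof -
    consider "k \<le> j" | "d - r + j \<le> k" | "j \<le> k" "k < d - r + j" by linarith
    then show ?thesis
    proof cases
      case 1
      then show ?thesis using low sum_water_fill_le[of j r lam k c] jr by (simp add: d_def)
    next
      case 2
      define l where "l = k - (d - r)"
      have l: "k = d - r + l" "j \<le> l" "l \<le> r" using 2 that jr by (auto simp: l_def)
      then show ?thesis
        using high[of l] sum_water_fill_ge[of j r lam l c] jr by (simp add: d_def)
    next
      case 3
      define p where "p = k - j"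
      have p: "k = j + p" "p \<le> d - r" using 3 by (auto simp: p_def)
      have nu: "(\<Sum>i<k. ?nu ! i) = (\<Sum>i<j. lam ! i) + real p * c"
        using sum_water_fill_plus[of j r lam p c] jr p by (simp add: d_def)
      show ?thesis
      \<comment> \<open>The entry \<open>mu ! k\<close> decides from which end of the plateau to
        compare. If it is at least \<open>c\<close>, the partial sums of \<open>mu\<close> grow at
        least at rate \<open>c\<close> from \<open>j\<close> up to \<open>k\<close>; otherwise they
        grow at rate at most \<open>c\<close> from \<open>k\<close> to the right end, where
        \<open>high\<close> applies with \<open>l = j\<close>.\<close>
      proof (cases "c \<le> mu ! k")
        case True
        have "real p * c = (\<Sum>i\<in>{j..<k}. c)" using p by simp
        also have "\<dots> \<le> (\<Sum>i\<in>{j..<k}. mu ! i)"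
        proof (rule sum_mono)
          fix i assume "i \<in> {j..<k}"
          then have "mu ! k \<le> mu ! i"
            using sorted_rev_nth_mono[OF mu(1)] mu(2) 3 jr by (simp add: d_def)
          then show "c \<le> mu ! i" using True by simp
        qed
        finally have "real p * c \<le> (\<Sum>i\<in>{j..<k}. mu ! i)" .
        moreover have "(\<Sum>i<k. mu ! i) = (\<Sum>i<j. mu ! i) + (\<Sum>i\<in>{j..<k}. mu ! i)"
          using 3 by (simp add: sum.atLeastLessThan_concat lessThan_atLeast0)
        ultimately show ?thesis using nu low[of j] by simp
      next
        case False
        have "(\<Sum>i\<in>{k..<d - r + j}. mu ! i) \<le> (\<Sum>i\<in>{k..<d - r + j}. c)"
        proof (rule sum_mono)
          fix i assume "i \<in> {k..<d - r + j}"
          then have "k \<le> i" "i < d" using jr by auto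
          then have "mu ! i \<le> mu ! k"
            using sorted_rev_nth_mono[OF mu(1), of k i] mu(2) jr by (simp add: d_def)
          then show "mu ! i \<le> c" using False by simp
        qed
        also have "\<dots> = (real d - real r - real p) * c"
          using p jr by (simp add: of_nat_diff)
        finally have "(\<Sum>i\<in>{k..<d - r + j}. mu ! i) \<le> (real d - real r - real p) * c" .
        moreover have "(\<Sum>i<d - r + j. mu ! i) = (\<Sum>i<k. mu ! i) + (\<Sum>i\<in>{k..<d - r + j}. mu ! i)"
          using 3 by (simp add: sum.atLeastLessThan_concat lessThan_atLeast0)
        ultimately show ?thesis
          using nu high[of j] jr by (simp add: d_def algebra_simps)
      qed
    qed
  qed
  then show ?thesis
    using length_water_fill[of j r lam c] jr mu sorted_water_fill[OF w srt]
    by (simp add: weakly_majorized_def decreasing_rearr_def sort_eq_rev_if_sorted d_def)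
qed

section \<open>Minimality\<close>

lemma adjoint_add:
  fixes A B :: "complex mat"
  assumes "A \<in> carrier_mat d d" "B \<in> carrier_mat d d"
  shows "mat_adjoint (A + B) = mat_adjoint A + mat_adjoint B"
  using assms by (intro eq_matI) (auto simp: index_mat_adjoint)

lemma psd_matsD:
  assumes "A \<in> psd_mats d"
  shows "A \<in> carrier_mat d d" "mat_adjoint A = A"
    "x \<in> carrier_vec d \<Longrightarrow> 0 \<le> Re ((A *\<^sub>v x) \<bullet>c x)"
  using assms by (auto simp: psd_mats_def)

lemma quadratic_form_add:
  fixes A B :: "complex mat"
  assumes "A \<in> carrier_mat d d" "B \<in> carrier_mat d d" "x \<in> carrier_vec d"
  shows "Re (((A + B) *\<^sub>v x) \<bullet>c x) = Re ((A *\<^sub>v x) \<bullet>c x) + Re ((B *\<^sub>v x) \<bullet>c x)"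
proof -
  have "A *\<^sub>v x \<in> carrier_vec d" "B *\<^sub>v x \<in> carrier_vec d" using assms by simp_all
  then show ?thesis
    using assms by (simp add: add_mult_distrib_mat_vec[of _ d d] add_scalar_prod_distrib[of _ d])
qed

text \<open>The alternative in the rank assumption mirrors the one in \<open>water_level\<close>.
  Positivity of \<open>B\<close> turns the vanishing forms of \<open>extend_orthonormal\<close> into
  kernel vectors.\<close>

lemma extend_with_kernel:
  assumes v: "orthonormal_family d d v" and B: "B \<in> psd_mats d"
    and "l \<le> r" "r \<le> d" and rank: "l = r \<or> vec_space.rank d B + r \<le> d"
  obtains u where "orthonormal_family d d u" "\<And>i. i < l \<Longrightarrow> u i = v i"
    "\<And>i. l \<le> i \<Longrightarrow> i < r \<Longrightarrow> B *\<^sub>v u i = 0\<^sub>v d"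
proof (cases "l = r")
  case True
  then show ?thesis using v that[of v] by auto
next
  case False
  have "orthonormal_family d l v"
    using v assms(3,4) by (auto simp: orthonormal_family_def)
  then obtain x where x: "orthonormal_family d r x" "\<forall>i<l. x i = v i"
    "\<forall>i. l \<le> i \<longrightarrow> i < r \<longrightarrow> Re ((B *\<^sub>v x i) \<bullet>c x i) = 0"
    using extend_orthonormal[of d l v B r] psd_matsD[OF B] assms False by auto
  obtain u where u: "orthonormal_family d d u" "\<And>i. i < r \<Longrightarrow> u i = x i"
    using extend_orthonormal_basis[OF x(1) \<open>r \<le> d\<close>] by auto
  have "B *\<^sub>v u i = 0\<^sub>v d" if "l \<le> i" "i < r" for i
    using that x u orthonormal_familyD(1)[OF x(1), of i] by (intro psd_form_eq_0[OF B]) auto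
  then show ?thesis using that[OF u(1)] u(2) x(2) \<open>l \<le> r\<close> by auto
qed

text \<open>Up to \<open>j\<close>, eigenvectors of \<open>S0\<close> are test vectors for
  \<open>S0 + B\<close>. Past the plateau, Ky Fan's inequality is used twice. For \<open>S0\<close>
  on the first \<open>r\<close> vectors it limits the share of the trace taken by the kernel vectors
  \<open>l, ..., r - 1\<close>, on which \<open>S0 + B\<close> agrees with \<open>S0\<close>. The
  other \<open>d - r + l\<close> vectors must carry the rest of \<open>t\<close>, and for
  \<open>S0 + B\<close> their share is at most the sum of as many leading eigenvalues.\<close>

lemma U_set_eigvals_majorize:
  assumes S0: "S0 \<in> psd_mats d" and B: "B \<in> psd_mats d"
    and w: "water_level (eigvals_desc S0) m t j r c"
    and rank: "int (vec_space.rank d B) \<le> int d - m" and t: "t \<le> Re (mat_trace (S0 + B))"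
  shows "water_fill (eigvals_desc S0) j r c \<prec>\<^sub>w eigvals_desc (S0 + B)"
proof -
  let ?S = "S0 + B"
  define lam where "lam = eigvals_desc S0"
  note S0D = psd_matsD[OF S0] and BD = psd_matsD[OF B]
  have S: "?S \<in> carrier_mat d d" "mat_adjoint ?S = ?S"
    using S0D BD adjoint_add[of S0 d B] by auto
  have d: "length lam = d" using length_eigvals_desc[OF S0D(1)] by (simp add: lam_def)
  obtain v where v: "orthonormal_family d d v" "real_eigenvectors S0 d v (nth lam)"
    using spectral_theorem[OF S0D(1,2)] unfolding lam_def .
  have w': "j \<le> r" "r < d" "j = r \<or> int r = m" "(\<Sum>i<r. lam ! i) + (real d - real r) * c = t"
    using w by (auto simp: water_level_def d lam_def[symmetric])
  have q0: "Re ((S0 *\<^sub>v v i) \<bullet>c v i) = lam ! i" if "i < d" for i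
    using eigenbasis_cscalar[OF S0D(1,2) v _ that] orthonormal_familyD[OF v(1)] that by simp
  show ?thesis
    unfolding lam_def[symmetric]
  proof (rule water_fill_majorized[OF w[folded lam_def]])
    show "sorted (rev lam)" "sorted (rev (eigvals_desc ?S))"
      by (simp_all add: lam_def sorted_eigvals_desc)
    show "length (eigvals_desc ?S) = length lam"
      using length_eigvals_desc[OF S(1)] d by simp
  next
    fix k assume k: "k \<le> j"
    have "(\<Sum>i<k. lam ! i) \<le> (\<Sum>i<k. Re ((?S *\<^sub>v v i) \<bullet>c v i))"
    proof (rule sum_mono)
      fix i assume "i \<in> {..<k}"
      then have i: "i < d" using k w' by simp
      note vi = orthonormal_familyD(1)[OF v(1) i]
      show "lam ! i \<le> Re ((?S *\<^sub>v v i) \<bullet>c v i)"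
        using quadratic_form_add[OF S0D(1) BD(1) vi] q0[OF i] BD(3)[OF vi] by simp
    qed
    also have "\<dots> \<le> (\<Sum>i<k. eigvals_desc ?S ! i)"
      using ky_fan[OF S v(1), of "{..<k}"] k w' by auto
    finally show "(\<Sum>i<k. lam ! i) \<le> (\<Sum>i<k. eigvals_desc ?S ! i)" .
  next
    fix l assume l: "j \<le> l" "l \<le> r"
    obtain u where u: "orthonormal_family d d u" "\<And>i. i < l \<Longrightarrow> u i = v i"
      "\<And>i. l \<le> i \<Longrightarrow> i < r \<Longrightarrow> B *\<^sub>v u i = 0\<^sub>v d"
    proof -
      have "l = r \<or> vec_space.rank d B + r \<le> d" using w' l rank by linarith
      then show ?thesis
        using extend_with_kernel[OF v(1) B l(2), of thesis] w'(2) that by simp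
    qed
    note uc = orthonormal_familyD(1)[OF u(1)]
    define q where "q A i = Re ((A *\<^sub>v u i) \<bullet>c u i)" for A i
    have qS: "q ?S i = q S0 i" if "l \<le> i" "i < r" for i
      using quadratic_form_add[OF S0D(1) BD(1) uc[of i]] that w' u(3)[OF that] uc[of i]
      by (simp add: q_def)
    have "(\<Sum>i<r. q S0 i) \<le> (\<Sum>i<r. lam ! i)"
      using ky_fan[OF S0D(1,2) u(1), of "{..<r}"] w' by (simp add: q_def lam_def)
    moreover have "(\<Sum>i<r. q S0 i) = (\<Sum>i<l. lam ! i) + (\<Sum>i\<in>{l..<r}. q ?S i)"
    proof -
      have "(\<Sum>i<r. q S0 i) = (\<Sum>i<l. q S0 i) + (\<Sum>i\<in>{l..<r}. q S0 i)"
        using l by (simp add: sum.atLeastLessThan_concat lessThan_atLeast0)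
      moreover have "(\<Sum>i<l. q S0 i) = (\<Sum>i<l. lam ! i)"
        using u(2) q0 l w' by (intro sum.cong) (auto simp: q_def)
      ultimately show ?thesis using qS by simp
    qed
    moreover have "(\<Sum>i\<in>{..<l} \<union> {r..<d}. q ?S i) \<le> (\<Sum>i<d - r + l. eigvals_desc ?S ! i)"
    proof -
      have "card ({..<l} \<union> {r..<d}) = d - r + l"
        using l by (subst card_Un_disjoint) auto
      then show ?thesis
        using ky_fan[OF S u(1), of "{..<l} \<union> {r..<d}"] l w' by (force simp: q_def)
    qed
    moreover have "t \<le> (\<Sum>i<d. q ?S i)"
      using t trace_eq_sum_forms[OF S(1) u(1)] by (simp add: q_def)
    moreover have "(\<Sum>i<d. q ?S i) = (\<Sum>i\<in>{..<l} \<union> {r..<d}. q ?S i) + (\<Sum>i\<in>{l..<r}. q ?S i)"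
    proof -
      have "{..<d} = ({..<l} \<union> {r..<d}) \<union> {l..<r}" using l w' by auto
      moreover have "({..<l} \<union> {r..<d}) \<inter> {l..<r} = {}" using l by auto
      ultimately show ?thesis
        using sum.union_disjoint[of "{..<l} \<union> {r..<d}" "{l..<r}" "q ?S"] by simp
    qed
    ultimately show "(\<Sum>i<l. lam ! i) + (real (length lam) - real r) * c
        \<le> (\<Sum>i<length lam - r + l. eigvals_desc ?S ! i)"
      using w'(4) d by simp
  qed
qed

section \<open>The structure of the minimizers\<close>

text \<open>The rank-one sum of condition (b), with the index shift undone.\<close>

definition minimizer :: "nat \<Rightarrow> real list \<Rightarrow> nat \<Rightarrow> real \<Rightarrow> (nat \<Rightarrow> complex vec) \<Rightarrow> complex mat" where
  "minimizer d lam r c v = spectral_sum d {r..<d} (\<lambda>i. c - lam ! i) v"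

lemma eigvals_minimizer:
  assumes S0: "S0 \<in> psd_mats d" and v: "orthonormal_family d d v"
    and a: "real_eigenvectors S0 d v (nth (eigvals_desc S0))"
    and w: "water_level (eigvals_desc S0) m t j r c"
  shows "eigvals_desc (S0 + minimizer d (eigvals_desc S0) r c v) = water_fill (eigvals_desc S0) j r c"
proof -
  define lam where "lam = eigvals_desc S0"
  let ?B = "minimizer d lam r c v"
  note S0D = psd_matsD[OF S0]
  have d: "length lam = d" using length_eigvals_desc[OF S0D(1)] by (simp add: lam_def)
  have w': "j \<le> r" "r < d" using w by (auto simp: water_level_def d lam_def[symmetric])
  have B: "?B \<in> carrier_mat d d" by (simp add: minimizer_def)
  define b where "b = take r lam @ replicate (d - r) c"
  have "real_eigenvectors (S0 + ?B) d v (nth b)"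
    unfolding real_eigenvectors_def
  proof (intro allI impI)
    fix i assume i: "i < d"
    note vi = orthonormal_familyD(1)[OF v i]
    have "{r..<d} \<subseteq> {..<d}" by auto
    then have "(S0 + ?B) *\<^sub>v v i = of_real (lam ! i) \<cdot>\<^sub>v v i + of_real (if r \<le> i then c - lam ! i else 0) \<cdot>\<^sub>v v i"
      using a[folded lam_def] i vi S0D(1) B
        spectral_sum_mult_basis[OF v _ i, of "{r..<d}" "\<lambda>i. c - lam ! i"]
      by (auto simp: add_mult_distrib_mat_vec[of _ d d] real_eigenvectors_def minimizer_def)
    also have "\<dots> = of_real (b ! i) \<cdot>\<^sub>v v i"
      using i w' d vi by (auto simp: b_def nth_append simp flip: add_smult_distrib_vec of_real_add)
    finally show "(S0 + ?B) *\<^sub>v v i = of_real (b ! i) \<cdot>\<^sub>v v i" .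
  qed
  then have "eigvals_desc (S0 + ?B) = rev (sort b)"
    using S0D(1) B v d w' by (intro eigvals_desc_eq) (auto simp: b_def)
  also have "\<dots> = water_fill lam j r c"
    using w w' by (intro rev_sort_eqI)
      (auto simp: b_def mset_water_fill lam_def d[unfolded lam_def]
        intro: sorted_water_fill sorted_eigvals_desc)
  finally show ?thesis by (simp add: lam_def)
qed

text \<open>Positivity comes from \<open>lam ! i \<le> c\<close> for \<open>i \<ge> r\<close>, the
  rank bound from having \<open>d - r\<close> summands and \<open>m \<le> r\<close>, and the trace
  is exactly \<open>t\<close> by the last clause of \<open>water_level\<close>.\<close>

lemma minimizer_in_U_set:
  assumes S0: "S0 \<in> psd_mats d" and v: "orthonormal_family d d v"
    and a: "real_eigenvectors S0 d v (nth (eigvals_desc S0))"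
    and w: "water_level (eigvals_desc S0) m t j r c"
  shows "S0 + minimizer d (eigvals_desc S0) r c v \<in> U_set d t S0 m"
proof -
  define lam where "lam = eigvals_desc S0"
  let ?B = "minimizer d lam r c v"
  note S0D = psd_matsD[OF S0]
  have d: "length lam = d" using length_eigvals_desc[OF S0D(1)] by (simp add: lam_def)
  have w': "j \<le> r" "r < d" "m \<le> int r" "\<And>i. j \<le> i \<Longrightarrow> i < d \<Longrightarrow> lam ! i \<le> c"
    using w by (auto simp: water_level_def d lam_def[symmetric])
  have B: "?B \<in> psd_mats d"
    unfolding minimizer_def using w' orthonormal_familyD(1)[OF v] by (intro spectral_sum_psd) auto
  have "vec_space.rank d ?B \<le> d - r"
    using rank_spectral_sum_le[of "{r..<d}" d] by (simp add: minimizer_def)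
  then have rank: "int (vec_space.rank d ?B) \<le> int d - m" using w' by simp
  have S: "S0 + ?B \<in> carrier_mat d d" "mat_adjoint (S0 + ?B) = S0 + ?B"
    using S0D psd_matsD[OF B] adjoint_add[of S0 d ?B] by auto
  have "mat_trace (S0 + ?B) = of_real t"
    using trace_eq_sum_eigvals[OF S] eigvals_minimizer[OF assms] sum_water_fill[OF w] d
    by (simp add: lam_def del: of_real_sum)
  then show ?thesis
    using B rank unfolding U_set_def lam_def by auto
qed

text \<open>Unlike in \<open>eigenvector_if_supported\<close>, only the basis vectors that occur in
  \<open>x\<close> are known to be eigenvectors. This carries eigenvector equations from one basis
  of a block to another.\<close>

lemma eigenvector_if_expansion_supported:
  assumes M: "M \<in> carrier_mat d d" "mat_adjoint M = M" and u: "orthonormal_family d d u"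
    and x: "x \<in> carrier_vec d"
    and supp: "\<And>p. p < d \<Longrightarrow> x \<bullet>c u p \<noteq> 0 \<Longrightarrow> M *\<^sub>v u p = of_real s \<cdot>\<^sub>v u p"
  shows "M *\<^sub>v x = of_real s \<cdot>\<^sub>v x"
proof (rule vec_eq_basisI[OF u])
  fix l assume l: "l < d"
  note uD = orthonormal_familyD[OF u]
  have Ml: "M *\<^sub>v u l \<in> carrier_vec d" using M uD(1)[OF l] by simp
  have "(M *\<^sub>v x) \<bullet>c u l = x \<bullet>c (M *\<^sub>v u l)"
    using hermitian_cscalar[OF M x uD(1)[OF l]] .
  also have "\<dots> = (\<Sum>p<d. (x \<bullet>c u p) * cnj ((M *\<^sub>v u l) \<bullet>c u p))"
    by (rule parseval[OF u x Ml])
  also have "\<dots> = (\<Sum>p<d. if p = l then of_real s * (x \<bullet>c u l) else 0)"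
  proof (intro sum.cong refl)
    fix p assume "p \<in> {..<d}"
    then have p: "p < d" by simp
    show "(x \<bullet>c u p) * cnj ((M *\<^sub>v u l) \<bullet>c u p) = (if p = l then of_real s * (x \<bullet>c u l) else 0)"
    proof (cases "x \<bullet>c u p = 0")
      case False
      have "(M *\<^sub>v u l) \<bullet>c u p = of_real s * (u l \<bullet>c u p)"
        using hermitian_cscalar[OF M uD(1)[OF l] uD(1)[OF p]] supp[OF p False] uD(1)[OF l] uD(1)[OF p]
        by (simp add: conjugate_smult_vec)
      then show ?thesis using uD(2)[OF l p] by auto
    qed auto
  qed
  finally show "(M *\<^sub>v x) \<bullet>c u l = (of_real s \<cdot>\<^sub>v x) \<bullet>c u l"
    using x uD(1)[OF l] l by simp
qed (use M x in auto)

lemma join_orthonormal: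
  assumes u: "orthonormal_family d d u" and "n \<le> d"
    and x: "orthonormal_family d n x" and y: "orthonormal_family d (d - n) y"
    and xu: "\<And>k i. k < n \<Longrightarrow> n \<le> i \<Longrightarrow> i < d \<Longrightarrow> x k \<bullet>c u i = 0"
    and yu: "\<And>k i. k < d - n \<Longrightarrow> i < n \<Longrightarrow> y k \<bullet>c u i = 0"
  shows "orthonormal_family d d (\<lambda>i. if i < n then x i else y (i - n))"
proof -
  note xD = orthonormal_familyD[OF x] and yD = orthonormal_familyD[OF y]
  have xy: "x i \<bullet>c y k = 0" if "i < n" "k < d - n" for i k
  proof -
    have "x i \<bullet>c y k = (\<Sum>l<d. (x i \<bullet>c u l) * cnj (y k \<bullet>c u l))"
      using parseval[OF u xD(1)[OF that(1)] yD(1)[OF that(2)]] .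
    also have "\<dots> = 0"
      using xu[OF that(1)] yu[OF that(2)] by (intro sum.neutral) (metis complex_cnj_zero lessThan_iff
        linorder_not_less mult_zero_left mult_zero_right)
    finally show ?thesis .
  qed
  have yx: "y k \<bullet>c x i = 0" if "i < n" "k < d - n" for i k
    using cscalar_commute[OF xD(1)[OF that(1)] yD(1)[OF that(2)]] xy[OF that] by simp
  show ?thesis
    unfolding orthonormal_family_def
    using xD yD xy yx by auto
qed

lemma smult_vec_diff:
  fixes x y :: "complex vec"
  assumes "of_real a \<cdot>\<^sub>v x = of_real b \<cdot>\<^sub>v x + y" "x \<in> carrier_vec d" "y \<in> carrier_vec d"
  shows "y = of_real (a - b) \<cdot>\<^sub>v x"
proof (rule eq_vecI)
  fix k assume "k < dim_vec (of_real (a - b) \<cdot>\<^sub>v x)"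
  then have "k < d" using assms by simp
  then show "y $ k = (of_real (a - b) \<cdot>\<^sub>v x) $ k"
    using arg_cong[OF assms(1), of "\<lambda>v. v $ k"] assms(2,3) by (simp add: algebra_simps)
qed (use assms in auto)

lemma minimizer_if_eigvals_eq:
  assumes S0: "S0 \<in> psd_mats d" and B: "B \<in> psd_mats d"
    and w: "water_level (eigvals_desc S0) m t j r c"
    and rank: "int (vec_space.rank d B) \<le> int d - m"
    and eig: "eigvals_desc (S0 + B) = water_fill (eigvals_desc S0) j r c"
  obtains v where "orthonormal_family d d v" "real_eigenvectors S0 d v (nth (eigvals_desc S0))"
    "B = minimizer d (eigvals_desc S0) r c v"
proof -
  define S where "S = S0 + B"
  define lam where "lam = eigvals_desc S0"
  note S0D = psd_matsD[OF S0] and BD = psd_matsD[OF B]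
  have S: "S \<in> carrier_mat d d" "mat_adjoint S = S"
    using S0D BD adjoint_add[of S0 d B] by (auto simp: S_def)
  have d: "length lam = d" using length_eigvals_desc[OF S0D(1)] by (simp add: lam_def)
  have srt: "sorted (rev lam)" by (simp add: lam_def sorted_eigvals_desc)
  note w = w[folded lam_def] and eig = eig[folded lam_def S_def]
  have w': "j \<le> r" "r < d" "j = r \<or> int r = m" "(\<Sum>i<r. lam ! i) + (real d - real r) * c = t"
    "\<And>i. j \<le> i \<Longrightarrow> i < d \<Longrightarrow> lam ! i \<le> c"
    using w by (auto simp: water_level_def d)
  have S_add: "S *\<^sub>v x = S0 *\<^sub>v x + B *\<^sub>v x" if "x \<in> carrier_vec d" for x
    using S0D(1) BD(1) that by (simp add: S_def add_mult_distrib_mat_vec[of _ d d])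
  have S_eq: "S *\<^sub>v x = S0 *\<^sub>v x" if "x \<in> carrier_vec d" "B *\<^sub>v x = 0\<^sub>v d" for x
    using S_add[OF that(1)] that S0D(1) by simp

  obtain v where v: "orthonormal_family d d v" "real_eigenvectors S0 d v (nth lam)"
    using spectral_theorem[OF S0D(1,2)] unfolding lam_def .
  note vc = orthonormal_familyD(1)[OF v(1)]
  \<comment> \<open>The partial sums of both spectra agree up to \<open>j\<close>, so Ky Fan's
    inequality leaves no room for the nonnegative form of \<open>B\<close> on these vectors.\<close>
  have Bv: "B *\<^sub>v v i = 0\<^sub>v d" if "i < j" for i
  proof -
    define q where "q i = Re ((B *\<^sub>v v i) \<bullet>c v i)" for i
    have q: "0 \<le> q i" if "i < j" for i
      using BD(3) vc that w' by (simp add: q_def)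
    have "(\<Sum>i<j. lam ! i + q i) = (\<Sum>i<j. Re ((S *\<^sub>v v i) \<bullet>c v i))"
    proof (intro sum.cong refl)
      fix i assume "i \<in> {..<j}"
      then have i: "i < d" using w' by simp
      have "Re ((S0 *\<^sub>v v i) \<bullet>c v i) = lam ! i"
        using eigenbasis_cscalar[OF S0D(1,2) v vc[OF i] i] orthonormal_familyD(2)[OF v(1) i i] by simp
      then show "lam ! i + q i = Re ((S *\<^sub>v v i) \<bullet>c v i)"
        using quadratic_form_add[OF S0D(1) BD(1) vc[OF i]] by (simp add: S_def q_def)
    qed
    also have "\<dots> \<le> (\<Sum>i<j. eigvals_desc S ! i)"
      using ky_fan[OF S v(1), of "{..<j}"] w' by auto
    also have "\<dots> = (\<Sum>i<j. lam ! i)"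
      using sum_water_fill_le[of j r lam j c] w' d by (simp add: eig)
    finally have "(\<Sum>i<j. q i) \<le> 0" by (simp add: sum.distrib)
    moreover have "0 \<le> (\<Sum>i<j. q i)" using q by (intro sum_nonneg) auto
    ultimately have "(\<Sum>i<j. q i) = 0" by simp
    then have "q i = 0" using that q sum_nonneg_eq_0_iff[of "{..<j}" q] by simp
    then show ?thesis using psd_form_eq_0[OF B vc[of i]] that w' by (simp add: q_def)
  qed

  obtain u where u: "orthonormal_family d d u" "\<And>i. i < j \<Longrightarrow> u i = v i"
    "\<And>i. j \<le> i \<Longrightarrow> i < r \<Longrightarrow> B *\<^sub>v u i = 0\<^sub>v d"
  proof -
    have "j = r \<or> vec_space.rank d B + r \<le> d" using w' rank by linarith
    then show ?thesis
      using extend_with_kernel[OF v(1) B w'(1), of thesis] w'(2) that by simp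
  qed
  note uc = orthonormal_familyD(1)[OF u(1)] and uo = orthonormal_familyD(2)[OF u(1)]
  have Bu: "B *\<^sub>v u i = 0\<^sub>v d" if "i < r" for i
    using u(2,3) Bv that by (cases "i < j") auto
  have Su: "S *\<^sub>v u i = S0 *\<^sub>v u i" if "i < r" for i
    using S_eq[OF uc Bu] that w' by simp
  have Suj: "S *\<^sub>v u i = of_real (lam ! i) \<cdot>\<^sub>v u i" if "i < j" for i
    using Su[of i] u(2)[OF that] v(2) that w' by (simp add: real_eigenvectors_def)

  \<comment> \<open>The vectors \<open>u 0, ..., u (j - 1)\<close> are eigenvectors of
    \<open>S\<close>, hence their complement is invariant. Cancelling their eigenvalues from the
    known spectrum leaves only values at most \<open>c\<close>, so that \<open>c\<close> bounds the
    form of \<open>S\<close> on unit vectors of the complement.\<close>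
  obtain y a where y: "orthonormal_family d (d - j) y" "length a = d - j" "sorted (rev a)"
    "real_eigenvectors S (d - j) y (nth a)"
    "\<And>k i. k < d - j \<Longrightarrow> i < d \<Longrightarrow> i \<notin> {j..<j + (d - j)} \<Longrightarrow> y k \<bullet>c u i = 0"
  proof (rule diagonalize_block_sorted[OF S u(1), of j "d - j"])
    show "j + (d - j) \<le> d" using w' by simp
    fix k i assume "k < d - j" "i < d" "i \<notin> {j..<j + (d - j)}"
    then have k: "j + k < d" "i < j" "i < d" by auto
    have "(S *\<^sub>v u (j + k)) \<bullet>c u i = u (j + k) \<bullet>c (S *\<^sub>v u i)"
      using hermitian_cscalar[OF S uc[OF k(1)] uc[OF k(3)]] .
    then show "(S *\<^sub>v u (j + k)) \<bullet>c u i = 0"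
      using Suj[OF k(2)] uc[OF k(1)] uc[OF k(3)] uo[OF k(1,3)] k(2) by (simp add: conjugate_smult_vec)
  qed (use that in blast)
  define f where "f i = (if i < j then u i else y (i - j))" for i
  define b where "b = take j lam @ a"
  have f: "orthonormal_family d d f"
    unfolding f_def using u(1) w' uo y(5)
    by (intro join_orthonormal[OF u(1) _ _ y(1)]) (auto simp: orthonormal_family_def)
  have fb: "real_eigenvectors S d f (nth b)"
    using Suj y(4) w' d by (auto simp: real_eigenvectors_def f_def b_def nth_append)
  have "eigvals_desc S = rev (sort b)"
    using eigvals_desc_eq[OF S(1) f fb] y(2) w' d by (simp add: b_def)
  then have "mset b = mset (water_fill lam j r c)"
    using eig by (metis mset_rev mset_sort)
  then have "mset a = mset (replicate (d - r) c @ drop j (take r lam))"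
    by (simp add: b_def water_fill_def d)
  then have "set a = set (replicate (d - r) c @ drop j (take r lam))"
    by (metis set_mset_mset)
  then have a_le: "x \<le> c" if "x \<in> set a" for x
    using that w'(1,2) d by (fastforce simp: in_set_conv_nth intro: w'(5))
  have below: "b ! l \<le> c \<or> u i \<bullet>c f l = 0" if "r \<le> i" "i < d" "l < d" for i l
  proof (cases "l < j")
    case True
    then show ?thesis using uo[of i l] that w' by (simp add: f_def)
  next
    case False
    then have "b ! l \<in> set a" using that y(2) w' d by (simp add: b_def nth_append)
    then show ?thesis using a_le by simp
  qed
  define q where "q i = Re ((S *\<^sub>v u i) \<bullet>c u i)" for i
  have q_le: "q i \<le> c" if "r \<le> i" "i < d" for i
    unfolding q_def using quadratic_form_le(1)[OF S f fb uc] uo below that by simp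
  \<comment> \<open>The first \<open>r\<close> forms sum to at most the first \<open>r\<close>
    entries of \<open>lam\<close>, each other form is at most \<open>c\<close>, and these bounds add
    up to the trace \<open>t\<close>. Hence every form from \<open>r\<close> on equals
    \<open>c\<close>.\<close>
  have "(\<Sum>i<d. q i) = Re (mat_trace S)"
    using trace_eq_sum_forms[OF S(1) u(1)] by (simp add: q_def)
  also have "\<dots> = t"
    using trace_eq_sum_eigvals[OF S] sum_water_fill[OF w] d by (simp add: eig)
  finally have "(\<Sum>i<d. q i) = t" .
  moreover have "(\<Sum>i<r. q i) \<le> (\<Sum>i<r. lam ! i)"
    using ky_fan[OF S0D(1,2) u(1), of "{..<r}"] w' Su by (simp add: q_def lam_def)
  moreover have "(\<Sum>i<d. q i) = (\<Sum>i<r. q i) + (\<Sum>i\<in>{r..<d}. q i)"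
    using w' by (simp add: sum.atLeastLessThan_concat lessThan_atLeast0)
  ultimately have "(\<Sum>i\<in>{r..<d}. c - q i) \<le> 0"
    using w'(2,4) by (simp add: sum_subtractf of_nat_diff)
  moreover have "0 \<le> (\<Sum>i\<in>{r..<d}. c - q i)"
    using q_le by (intro sum_nonneg) auto
  ultimately have "(\<Sum>i\<in>{r..<d}. c - q i) = 0" by simp
  then have q_eq: "q i = c" if "r \<le> i" "i < d" for i
    using that q_le sum_nonneg_eq_0_iff[of "{r..<d}" "\<lambda>i. c - q i"] by simp
  have Su_c: "S *\<^sub>v u i = of_real c \<cdot>\<^sub>v u i" if "r \<le> i" "i < d" for i
    using quadratic_form_le(2)[OF S f fb uc, of i c] uo below q_eq that by (simp add: q_def)

  \<comment> \<open>\<open>S\<close> is the scalar \<open>c\<close> on the second block and so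
    preserves both. On the first block it agrees with \<open>S0\<close>, which makes that block
    invariant under \<open>S0\<close>; Hermitian symmetry then gives the invariance of the
    second.\<close>
  have S_block: "(S *\<^sub>v u k) \<bullet>c u i = 0" if "k < d" "i < r" "r \<le> k" for k i
    using Su_c[OF that(3,1)] uc[OF that(1)] uc[of i] uo[OF that(1), of i] that w' by simp
  have S_block': "(S0 *\<^sub>v u i) \<bullet>c u k = 0" "(S0 *\<^sub>v u k) \<bullet>c u i = 0" if "k < d" "i < r" "r \<le> k" for k i
  proof -
    have i: "i < d" using that w' by simp
    have 1: "u k \<bullet>c (S *\<^sub>v u i) = 0"
      using hermitian_cscalar[OF S uc[OF that(1)] uc[OF i]] S_block[OF that] by simp
    then show "(S0 *\<^sub>v u k) \<bullet>c u i = 0"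
      using hermitian_cscalar[OF S0D(1,2) uc[OF that(1)] uc[OF i]] Su[OF that(2)] by simp
    have "S0 *\<^sub>v u i \<in> carrier_vec d" using S0D(1) uc[OF i] by simp
    then show "(S0 *\<^sub>v u i) \<bullet>c u k = 0"
      using cscalar_commute[OF uc[OF that(1)], of "S0 *\<^sub>v u i"] 1 Su[OF that(2)] by simp
  qed
  obtain w1 l1 where w1: "orthonormal_family d r w1" "length l1 = r" "sorted (rev l1)"
    "real_eigenvectors S0 r w1 (nth l1)"
    "\<And>k i. k < r \<Longrightarrow> i < d \<Longrightarrow> i \<notin> {0..<0 + r} \<Longrightarrow> w1 k \<bullet>c u i = 0"
    by (rule diagonalize_block_sorted[OF S0D(1,2) u(1), of 0 r]) (use w' S_block' in auto)
  obtain w2 l2 where w2: "orthonormal_family d (d - r) w2" "length l2 = d - r" "sorted (rev l2)"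
    "real_eigenvectors S0 (d - r) w2 (nth l2)"
    "\<And>k i. k < d - r \<Longrightarrow> i < d \<Longrightarrow> i \<notin> {r..<r + (d - r)} \<Longrightarrow> w2 k \<bullet>c u i = 0"
    by (rule diagonalize_block_sorted[OF S0D(1,2) u(1), of r "d - r"]) (use w' S_block' in auto)
  define z where "z i = (if i < r then w1 i else w2 (i - r))" for i
  have z: "orthonormal_family d d z"
    unfolding z_def using w' w1(5) w2(5)
    by (intro join_orthonormal[OF u(1) _ w1(1) w2(1)]) auto
  note zc = orthonormal_familyD(1)[OF z]
  have zl: "real_eigenvectors S0 d z (nth (l1 @ l2))"
    using w1(2,4) w2(2,4) w' by (auto simp: real_eigenvectors_def z_def nth_append)
  have Bz: "B *\<^sub>v z i = 0\<^sub>v d" if "i < r" for i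
  proof -
    have i: "i < d" using that w' by simp
    have "B *\<^sub>v z i = of_real 0 \<cdot>\<^sub>v z i"
    proof (rule eigenvector_if_expansion_supported[OF BD(1,2) u(1) zc[OF i]])
      fix p assume p: "p < d" "z i \<bullet>c u p \<noteq> 0"
      then have "p < r" using w1(5)[of i p] that by (auto simp: z_def)
      then show "B *\<^sub>v u p = of_real 0 \<cdot>\<^sub>v u p" using Bu uc[OF p(1)] by (auto intro!: eq_vecI)
    qed
    then show ?thesis using zc[OF i] by (auto intro!: eq_vecI)
  qed
  have Sz: "S *\<^sub>v z i = of_real c \<cdot>\<^sub>v z i" if "r \<le> i" "i < d" for i
  proof (rule eigenvector_if_expansion_supported[OF S u(1) zc[OF that(2)]])
    fix p assume p: "p < d" "z i \<bullet>c u p \<noteq> 0"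
    then have "r \<le> p" using w2(5)[of "i - r" p] that by (force simp: z_def)
    then show "S *\<^sub>v u p = of_real c \<cdot>\<^sub>v u p" using Su_c p(1) by simp
  qed
  \<comment> \<open>It is not clear yet that the first block carries the \<open>r\<close> largest
    eigenvalues of \<open>S0\<close>. Cancelling the copies of \<open>c\<close> from two
    descriptions of the spectrum of \<open>S\<close> gives \<open>l1\<close> the entries of
    \<open>take r lam\<close>; the spectrum of \<open>S0\<close> then leaves those of
    \<open>drop r lam\<close> for \<open>l2\<close>. As all lists are decreasing, \<open>z\<close>
    is an eigenbasis in the order of \<open>lam\<close>.\<close>
  have "real_eigenvectors S d z (nth (l1 @ replicate (d - r) c))"
    unfolding real_eigenvectors_def
  proof (intro allI impI)
    fix i assume i: "i < d"
    show "S *\<^sub>v z i = of_real ((l1 @ replicate (d - r) c) ! i) \<cdot>\<^sub>v z i"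
    proof (cases "i < r")
      case True
      then show ?thesis
        using S_eq[OF zc[OF i] Bz[OF True]] zl i w1(2) by (simp add: real_eigenvectors_def nth_append)
    next
      case False
      then show ?thesis using Sz[of i] i w1(2) by (simp add: nth_append)
    qed
  qed
  then have "water_fill lam j r c = rev (sort (l1 @ replicate (d - r) c))"
    using eigvals_desc_eq[OF S(1) z] w1(2) w' eig by simp
  then have "mset (l1 @ replicate (d - r) c) = mset (water_fill lam j r c)"
    by (metis mset_rev mset_sort)
  also have "\<dots> = mset (take r lam @ replicate (d - r) c)"
    using mset_water_fill[of j r lam c] w' d by simp
  finally have m1: "mset l1 = mset (take r lam)" by simp
  have lam: "lam = rev (sort (l1 @ l2))"
    using eigvals_desc_eq[OF S0D(1) z zl] w1(2) w2(2) w' by (simp add: lam_def)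
  then have "mset lam = mset l1 + mset l2" by (metis mset_append mset_rev mset_sort)
  moreover have "mset lam = mset (take r lam) + mset (drop r lam)"
    by (metis append_take_drop_id mset_append)
  ultimately have m2: "mset l2 = mset (drop r lam)" using m1 by simp
  have "sorted (rev (take r lam))" "sorted (rev (drop r lam))"
    using srt by (simp_all add: rev_take rev_drop sorted_wrt_take sorted_wrt_drop)
  then have "l1 = take r lam" "l2 = drop r lam"
    using m1 m2 w1(3) w2(3) by (metis rev_sort_eqI)+
  then have zlam: "real_eigenvectors S0 d z (nth lam)" using zl by simp
  have "B = minimizer d lam r c z"
    unfolding minimizer_def
  proof (rule mat_eq_basisI[OF z BD(1) spectral_sum_carrier])
    fix i assume i: "i < d"
    have sub: "{r..<d} \<subseteq> {..<d}" by auto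
    show "B *\<^sub>v z i = spectral_sum d {r..<d} (\<lambda>i. c - lam ! i) z *\<^sub>v z i"
    proof (cases "i < r")
      case True
      have "of_real 0 \<cdot>\<^sub>v z i = 0\<^sub>v d"
        using zc[OF i] by (intro eq_vecI) auto
      then show ?thesis
        using Bz[OF True] spectral_sum_mult_basis[OF z sub i, of "\<lambda>i. c - lam ! i"] True by simp
    next
      case False
      have Bc: "B *\<^sub>v z i \<in> carrier_vec d" using BD(1) zc[OF i] by simp
      have "of_real c \<cdot>\<^sub>v z i = of_real (lam ! i) \<cdot>\<^sub>v z i + B *\<^sub>v z i"
        using S_add[OF zc[OF i]] Sz[of i] False i zlam by (simp add: real_eigenvectors_def)
      then have "B *\<^sub>v z i = of_real (c - lam ! i) \<cdot>\<^sub>v z i"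
        using zc[OF i] Bc by (rule smult_vec_diff)
      then show ?thesis
        using spectral_sum_mult_basis[OF z sub i, of "\<lambda>i. c - lam ! i"] i False by simp
    qed
  qed
  then show ?thesis using z zlam that by (simp add: lam_def)
qed

text \<open>With coefficients depending only on the eigenvalue, the sum is a function of
  \<open>A\<close>. Concretely, \<open>v k\<close> is orthogonal to every \<open>w l\<close> of
  another eigenvalue, so it only meets vectors with its own coefficient.\<close>

lemma spectral_sum_eigenbasis_unique:
  assumes A: "A \<in> carrier_mat d d" "mat_adjoint A = A"
    and v: "orthonormal_family d d v" "real_eigenvectors A d v a"
    and w: "orthonormal_family d d w" "real_eigenvectors A d w a"
    and I: "I \<subseteq> {..<d}"
    and g: "\<And>i k. i < d \<Longrightarrow> k < d \<Longrightarrow> a i = a k \<Longrightarrow>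
      (if i \<in> I then g i else 0) = (if k \<in> I then g k else (0 :: real))"
  shows "spectral_sum d I g v = spectral_sum d I g w"
proof (rule mat_eq_basisI[OF v(1)])
  let ?f = "\<lambda>i. if i \<in> I then g i else 0"
  fix k assume k: "k < d"
  note vk = orthonormal_familyD(1)[OF v(1) k]
  have "real_eigenvectors (spectral_sum d I g w) d w ?f"
    using spectral_sum_mult_basis[OF w(1) I] by (simp add: real_eigenvectors_def)
  then have "spectral_sum d I g w *\<^sub>v v k = of_real (?f k) \<cdot>\<^sub>v v k"
  proof (rule eigenvector_if_supported[OF spectral_sum_carrier adjoint_spectral_sum w(1) _ vk])
    fix l assume l: "l < d"
    have "of_real (a k) * (v k \<bullet>c w l) = (A *\<^sub>v v k) \<bullet>c w l"
      using v(2) k vk orthonormal_familyD(1)[OF w(1) l] by (simp add: real_eigenvectors_def)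
    also have "\<dots> = of_real (a l) * (v k \<bullet>c w l)"
      using eigenbasis_cscalar[OF A w vk l] .
    finally have "v k \<bullet>c w l = 0 \<or> a k = a l" by simp
    then show "(?f k - ?f l) * (cmod (v k \<bullet>c w l))\<^sup>2 = 0"
      using g[OF k l] by auto
  qed
  then show "spectral_sum d I g v *\<^sub>v v k = spectral_sum d I g w *\<^sub>v v k"
    using spectral_sum_mult_basis[OF v(1) I k] by simp
qed simp_all

text \<open>If equal eigenvalues lie on both sides of position \<open>r\<close>, their common value
  is \<open>c\<close> by \<open>water_level_separated\<close>, so the coefficient
  \<open>c - lam ! k\<close> agrees with the \<open>0\<close> before \<open>r\<close>.\<close>

lemma minimizer_unique:
  assumes S0: "S0 \<in> psd_mats d"
    and w: "water_level (eigvals_desc S0) m t j r c"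
    and cond: "m \<le> 0 \<or> (m \<ge> 1 \<and> eigvals_desc S0 ! (nat m - 1) > eigvals_desc S0 ! nat m) \<or>
     (m \<ge> 1 \<and> eigvals_desc S0 ! (nat m - 1) = eigvals_desc S0 ! nat m \<and> t \<le> s_star (eigvals_desc S0) (nat m))"
    and v: "orthonormal_family d d v" "real_eigenvectors S0 d v (nth (eigvals_desc S0))"
    and u: "orthonormal_family d d u" "real_eigenvectors S0 d u (nth (eigvals_desc S0))"
  shows "minimizer d (eigvals_desc S0) r c v = minimizer d (eigvals_desc S0) r c u"
proof -
  note S0D = psd_matsD[OF S0]
  note sep = water_level_separated[OF w sorted_eigvals_desc cond, unfolded length_eigvals_desc[OF S0D(1)]]
  show ?thesis
    unfolding minimizer_def
  proof (rule spectral_sum_eigenbasis_unique[OF S0D(1,2) v u])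
    fix i k assume ik: "i < d" "k < d" "eigvals_desc S0 ! i = eigvals_desc S0 ! k"
    then show "(if i \<in> {r..<d} then c - eigvals_desc S0 ! i else 0)
        = (if k \<in> {r..<d} then c - eigvals_desc S0 ! k else 0)"
      using sep[of i k] sep[of k i] by (cases "i < r"; cases "k < r") auto
  qed auto
qed

section \<open>Existence, characterization and uniqueness of the minimizer\<close>

lemma add_minus_cancel_left_mat:
  fixes A B :: "complex mat"
  assumes "A \<in> carrier_mat d d" "B \<in> carrier_mat d d"
  shows "A + B - A = B"
  using assms by (intro eq_matI) auto

theorem theorem3p12:
  fixes d :: nat and S0 :: "complex mat" and lam :: "real list"
    and m :: int and t c :: real and r' :: nat
  assumes "d \<ge> 1"
    and "S0 \<in> psd_mats d"
    and "lam = eigvals_desc S0"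
    and "m < int d"
    and "t \<ge> Re (mat_trace S0)"
    and "r' = nat (max (int (r_val_m lam m t)) m)"
    and "c = c_val_m lam m t"
  shows "\<exists>\<nu> \<in> Lambda_U d t S0 m.
    (\<forall>\<mu> \<in> Lambda_U d t S0 m. \<nu> \<prec>\<^sub>w \<mu>) \<and>
    (\<forall>S \<in> U_set d t S0 m.
       eigvals_desc S = \<nu> \<longleftrightarrow>
       (\<exists>v. orthonormal_eigenbasis d S0 lam v \<and>
          S - S0 = (\<Oplus>\<^bsub>module_mat TYPE(complex) d d\<^esub>i\<in>{0..<d - r'}.
            complex_of_real (c - lam ! (r' + i)) \<cdot>\<^sub>m rank_one (v (r' + i)) (v (r' + i))))) \<and>
    (m \<le> 0 \<or>
     (m \<ge> 1 \<and> lam ! (nat m - 1) > lam ! nat m) \<or>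
     (m \<ge> 1 \<and> lam ! (nat m - 1) = lam ! nat m \<and> t \<le> s_star lam (nat m)) \<longrightarrow>
       (\<exists>!S. S \<in> U_set d t S0 m \<and> eigvals_desc S = \<nu>) \<and>
       (\<exists>!B. \<exists>S \<in> U_set d t S0 m. eigvals_desc S = \<nu> \<and> B = S - S0) \<and>
       (\<forall>S \<in> U_set d t S0 m. eigvals_desc S = \<nu> \<longrightarrow>
         (\<forall>v. orthonormal_eigenbasis d S0 lam v \<longrightarrow>
           S - S0 = (\<Oplus>\<^bsub>module_mat TYPE(complex) d d\<^esub>i\<in>{0..<d - r'}.
             complex_of_real (c - lam ! (r' + i)) \<cdot>\<^sub>m rank_one (v (r' + i)) (v (r' + i))))))"
proof -
  note S0 = assms(2) and lam = assms(3)
  note S0D = psd_matsD[OF S0]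
  have d: "length lam = d" using length_eigvals_desc[OF S0D(1)] by (simp add: lam)
  define j where "j = r_val_m lam m t"
  have "(\<Sum>i<length lam. lam ! i) \<le> t"
    using assms(5) trace_eq_sum_eigvals[OF S0D(1,2)] d by (simp add: lam)
  then have w: "water_level lam m t j r' c"
    using assms(1,4) d unfolding assms(6,7) j_def
    by (intro water_level_params) (auto simp: lam sorted_eigvals_desc)
  then have r': "r' < d" by (auto simp: water_level_def d)
  note w' = w[unfolded lam]
  define nu where "nu = water_fill lam j r' c"
  let ?M = "minimizer d lam r' c"
  have M_sum: "(\<Oplus>\<^bsub>module_mat TYPE(complex) d d\<^esub>i\<in>{0..<d - r'}.
      complex_of_real (c - lam ! (r' + i)) \<cdot>\<^sub>m rank_one (v (r' + i)) (v (r' + i))) = ?M v"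
    if "orthonormal_eigenbasis d S0 lam v" for v
    using that r' orthonormal_familyD(1)[of d d v]
      finsum_rank_one_eq_spectral_sum[of "d - r'" v r' d "\<lambda>i. c - lam ! i"]
    by (simp add: minimizer_def orthonormal_eigenbasis_iff)
  have M: "?M v \<in> carrier_mat d d" for v by (simp add: minimizer_def)
  have basis: "orthonormal_eigenbasis d S0 lam v \<longleftrightarrow>
      orthonormal_family d d v \<and> real_eigenvectors S0 d v (nth (eigvals_desc S0))" for v
    by (simp add: orthonormal_eigenbasis_iff lam)
  have eig_M: "eigvals_desc (S0 + ?M v) = nu" "S0 + ?M v \<in> U_set d t S0 m"
    if "orthonormal_eigenbasis d S0 lam v" for v
  proof -
    have v: "orthonormal_family d d v" "real_eigenvectors S0 d v (nth (eigvals_desc S0))"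
      using that basis by blast+
    show "eigvals_desc (S0 + ?M v) = nu" "S0 + ?M v \<in> U_set d t S0 m"
      using eigvals_minimizer[OF S0 v w'] minimizer_in_U_set[OF S0 v w']
      by (simp_all add: nu_def lam)
  qed
  have U: "\<exists>B. S = S0 + B \<and> S - S0 = B \<and> B \<in> psd_mats d \<and>
      int (vec_space.rank d B) \<le> int d - m \<and> t \<le> Re (mat_trace S)"
    if "S \<in> U_set d t S0 m" for S
    using that add_minus_cancel_left_mat[OF S0D(1)] psd_matsD(1)
    unfolding U_set_def by fastforce
  have char: "\<exists>v. orthonormal_eigenbasis d S0 lam v \<and> S = S0 + ?M v"
    if "S \<in> U_set d t S0 m" "eigvals_desc S = nu" for S
  proof -
    note US = U[OF that(1)]
    obtain B where B: "S = S0 + B" "B \<in> psd_mats d" "int (vec_space.rank d B) \<le> int d - m"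
      using US by blast
    have eq: "eigvals_desc (S0 + B) = water_fill (eigvals_desc S0) j r' c"
      using that(2) B(1) by (simp add: nu_def lam)
    show ?thesis
      using minimizer_if_eigvals_eq[OF S0 B(2) w' B(3) eq] B(1) basis lam by metis
  qed
  have diff: "S - S0 = ?M v \<longleftrightarrow> S = S0 + ?M v" if "S \<in> U_set d t S0 m" for S v
    using U[OF that] add_minus_cancel_left_mat[OF S0D(1) M] by metis
  \<comment> \<open>Any eigenbasis shows that \<open>nu\<close> is attained; in the uniqueness cases
    this one also names the unique matrix.\<close>
  obtain v0 where v0: "orthonormal_eigenbasis d S0 lam v0"
    using spectral_theorem[OF S0D(1,2)] basis by metis
  show ?thesis
  proof (rule bexI[of _ nu], intro conjI impI ballI allI)
    show "nu \<in> Lambda_U d t S0 m"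
      using eig_M[OF v0] unfolding Lambda_U_def by (metis imageI)
  next
    fix mu assume "mu \<in> Lambda_U d t S0 m"
    then obtain S where S: "S \<in> U_set d t S0 m" "mu = eigvals_desc S"
      by (auto simp: Lambda_U_def)
    obtain B where B: "S = S0 + B" "B \<in> psd_mats d"
      "int (vec_space.rank d B) \<le> int d - m" "t \<le> Re (mat_trace (S0 + B))"
      using S(1) unfolding U_set_def by auto
    show "nu \<prec>\<^sub>w mu"
      using U_set_eigvals_majorize[OF S0 B(2) w' B(3,4)] S(2) B(1) by (simp add: nu_def lam)
  next
    fix S assume S: "S \<in> U_set d t S0 m"
    show "eigvals_desc S = nu \<longleftrightarrow> (\<exists>v. orthonormal_eigenbasis d S0 lam v \<and>
          S - S0 = (\<Oplus>\<^bsub>module_mat TYPE(complex) d d\<^esub>i\<in>{0..<d - r'}.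
            complex_of_real (c - lam ! (r' + i)) \<cdot>\<^sub>m rank_one (v (r' + i)) (v (r' + i))))"
    proof
      assume "eigvals_desc S = nu"
      then obtain v where "orthonormal_eigenbasis d S0 lam v" "S = S0 + ?M v"
        using char[OF S] by blast
      then show "\<exists>v. orthonormal_eigenbasis d S0 lam v \<and>
          S - S0 = (\<Oplus>\<^bsub>module_mat TYPE(complex) d d\<^esub>i\<in>{0..<d - r'}.
            complex_of_real (c - lam ! (r' + i)) \<cdot>\<^sub>m rank_one (v (r' + i)) (v (r' + i)))"
        using diff[OF S] M_sum by (intro exI[of _ v]) simp
    next
      assume "\<exists>v. orthonormal_eigenbasis d S0 lam v \<and>
          S - S0 = (\<Oplus>\<^bsub>module_mat TYPE(complex) d d\<^esub>i\<in>{0..<d - r'}.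
            complex_of_real (c - lam ! (r' + i)) \<cdot>\<^sub>m rank_one (v (r' + i)) (v (r' + i)))"
      then obtain v where v: "orthonormal_eigenbasis d S0 lam v" and "S - S0 = ?M v"
        using M_sum by auto
      then show "eigvals_desc S = nu"
        using diff[OF S] eig_M(1)[OF v] by simp
    qed
  next
    assume cond: "m \<le> 0 \<or> (m \<ge> 1 \<and> lam ! (nat m - 1) > lam ! nat m) \<or>
     (m \<ge> 1 \<and> lam ! (nat m - 1) = lam ! nat m \<and> t \<le> s_star lam (nat m))"
    \<comment> \<open>\<open>char\<close> yields a formula for \<open>S\<close> in some eigenbasis,
      and \<open>minimizer_unique\<close> exchanges it for the prescribed one. Uniqueness and the
      formula in every eigenbasis both follow.\<close>
    have unique: "S = S0 + ?M v"
      if "S \<in> U_set d t S0 m" "eigvals_desc S = nu" "orthonormal_eigenbasis d S0 lam v" for S v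
      using char[OF that(1,2)] minimizer_unique[OF S0 w' cond[unfolded lam]] that(3) basis lam by metis
    show "\<exists>!S. S \<in> U_set d t S0 m \<and> eigvals_desc S = nu"
      using unique[OF _ _ v0] eig_M[OF v0] by blast
    then show "\<exists>!B. \<exists>S \<in> U_set d t S0 m. eigvals_desc S = nu \<and> B = S - S0"
      by blast
    fix S v assume S: "S \<in> U_set d t S0 m" "eigvals_desc S = nu" "orthonormal_eigenbasis d S0 lam v"
    show "S - S0 = (\<Oplus>\<^bsub>module_mat TYPE(complex) d d\<^esub>i\<in>{0..<d - r'}.
             complex_of_real (c - lam ! (r' + i)) \<cdot>\<^sub>m rank_one (v (r' + i)) (v (r' + i)))"
      using unique[OF S] diff[OF S(1)] M_sum[OF S(3)] by simp
  qed
qed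

end
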